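(* Let $\delta,\alpha,\lambda\ge0$. Suppose that the Combined Algorithm is given a predicted average load $v'_{avg}$ and predicted interval lengths $\ell'_I$ such that $v'_{avg}\in\left[\frac{v_{avg}}{1+\delta},\,v_{avg}(1+\delta)\right]$ and $\ell'_I\in\left[\frac{\ell_I}{1+\alpha},\,\ell_I(1+\lambda)\right]$ for every interval $I$. Then its total cost is at most (1) $(1+\alpha)(1+\lambda)\cdot\left(\mathrm{OPT}+T\cdot O\left(\sqrt{(1+\delta)v_{avg}\log\mu}\right)\right)$ in the uniform size case (with Next-Fit as the underlying static algorithm); (2) $(1+\alpha)(1+\lambda)\cdot\left(\Pi_k\cdot\mathrm{OPT}+T\cdot k\cdot O\left(\sqrt{(1+\delta)v_{avg}\log\mu}\right)\right)$ in the non-uniform size case (with Harmonic with parameter $k$ as the underlying static algorithm). Here $O(\cdot)$ hides an absolute constant.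
   Context: Dynamic bin packing. Time is discretized into steps $t=1,\dots,T$. An instance is a finite set of intervals $I=[s_I,e_I)$ with integer endpoints and size $w_I\in(0,1]$; $t\in I$ means $s_I\le t<e_I$ ($I$ active at $t$). The length is $\ell_I=e_I-s_I$; the minimum length is $1$ and $\mu$ is the maximum length. At each step at least one interval is active. Each interval is assigned to one machine for its entire duration; at each time the total size of active intervals on a machine is at most $1$. Total cost is the total time machines are active (have an active interval), summed over machines; $\mathrm{OPT}$ is the minimum offline cost. Uniform size case: all sizes equal $1/g$, $g\ge1$ an integer; non-uniform: arbitrary sizes. $v_{avg}=\frac1T\sum_{t=1}^T\lceil\sum_{I\ni t}w_I\rceil$ is the average load. Static algorithms. Next-Fit keeps one active bin; an item that does not fit closes it and opens a new one. Harmonic with parameter $k$ splits items into classes with sizes in $(\frac1{j+1},\frac1j]$ ($1\le j\le k-1$) and $(0,\frac1k]$ and packs each class separately by Next-Fit; $\Pi_k$ is its asymptotic competitive ratio for static bin packing (its number of bins is at most $\Pi_k$ times optimal, plus $k$). Dynamic non-clairvoyant algorithm with underlying bounded-space static algorithm $A$: when an interval $I$ arrives, feed an item of size $w_I$ to $A$; if $A$ opens a new bin, open a new machine associated with it; place $I$ on the machine associated with the bin into which $A$ packs the item. When the last interval on a machine departs, the machine is closed; if its bin is still active in $A$, a new machine is associated with the bin and opened only when a new item is packed into that bin. First-Fit: assign an arriving interval to the machine with the earliest opening time among open machines with enough free capacity; if none, open a new machine. Combined Algorithm, given average load value $V$ (here $V=v'_{avg}$) and lengths (here $\ell'_I$)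 revealed on arrival: let $\epsilon_j=\min\{1,\frac jV\}$ and $q_j=\min\{1,\sqrt{V/j}\}$ for $j\ge1$. Interval $I$ is in class $c^j$ if its given length lies in $[e^{\sum_{i<j}\epsilon_i},e^{\sum_{i\le j}\epsilon_i})$ (a given length below $1$ is treated as $1$). Keep one copy of First-Fit, and for each $j$ a separate copy of the dynamic non-clairvoyant algorithm, all on disjoint sets of machines. When $I\in c^j$ arrives at time $t$, let $v^j_t$ be the total size of class-$c^j$ intervals active at that moment, including $I$; if $v^j_t\le q_j$ schedule $I$ with the First-Fit copy, otherwise with the $j$-th copy of the dynamic non-clairvoyant algorithm. The bounds are understood for $\mu\ge2$. *)

theory Defs
  imports Complex_Main
begin

section \<open>Instances of dynamic bin packing\<close>

record interval =
  start :: nat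
  finish :: nat
  width :: real

definition active :: "interval \<Rightarrow> nat \<Rightarrow> bool" where
  "active I t \<longleftrightarrow> start I \<le> t \<and> t < finish I"

definition len :: "interval \<Rightarrow> real" where
  "len I = real (finish I) - real (start I)"

text \<open>
  An instance is a list, so that identical intervals may occur several times. The order of the
  list is the arrival order; in particular it fixes, arbitrarily, the order of intervals that
  start at the same step.
\<close>

definition packing_instance :: "nat \<Rightarrow> interval list \<Rightarrow> bool" where
  "packing_instance T Is \<longleftrightarrow>
     1 \<le> T \<and>
     sorted (map start Is) \<and>
     (\<forall>I\<in>set Is. 1 \<le> start I \<and> start I < finish I \<and> finish I \<le> T + 1
                  \<and> 0 < width I \<and> width I \<le> 1) \<and>
     (\<forall>t\<in>{1..T}. \<exists>I\<in>set Is. active I t) \<and>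
     Min (len ` set Is) = 1"

definition max_length :: "interval list \<Rightarrow> real" where
  "max_length Is = Max (len ` set Is)"

definition avg_load :: "nat \<Rightarrow> interval list \<Rightarrow> real" where
  "avg_load T Is =
     (\<Sum>t=1..T. of_int \<lceil>\<Sum>i | i < length Is \<and> active (Is ! i) t. width (Is ! i)\<rceil>) / real T"

text \<open>An assignment maps the position of an interval in the list to the name of its machine.\<close>

definition feasible :: "interval list \<Rightarrow> (nat \<Rightarrow> nat) \<Rightarrow> bool" where
  "feasible Is f \<longleftrightarrow>
     (\<forall>m t. (\<Sum>i | i < length Is \<and> f i = m \<and> active (Is ! i) t. width (Is ! i)) \<le> 1)"

definition cost :: "interval list \<Rightarrow> (nat \<Rightarrow> nat) \<Rightarrow> nat" where
  "cost Is f = (\<Sum>m \<in> f ` {..<length Is}. card {t. \<exists>i<length Is. f i = m \<and> active (Is ! i) t})"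

definition opt_cost :: "interval list \<Rightarrow> nat" where
  "opt_cost Is = (LEAST c. \<exists>f. feasible Is f \<and> cost Is f = c)"


section \<open>Static online algorithms\<close>

text \<open>
  A static online algorithm is a function that maps the sizes of the items packed so far, in order
  of arrival, and the size of the next item to the name of the bin into which that item is packed.
\<close>

type_synonym 'b static_alg = "real list \<Rightarrow> real \<Rightarrow> 'b"

text \<open>The state of Next-Fit: the number of closed bins and the level of the active bin.\<close>

fun next_fit_step :: "real \<Rightarrow> nat \<times> real \<Rightarrow> nat \<times> real" where
  "next_fit_step x (b, l) = (if l + x \<le> 1 then (b, l + x) else (b + 1, x))"

definition next_fit :: "nat static_alg" where
  "next_fit ws x = fst (fold next_fit_step (ws @ [x]) (0, 0))"

definition harmonic_class :: "nat \<Rightarrow> real \<Rightarrow> nat" where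
  "harmonic_class k x =
     (if x \<le> 1 / real k then k else (THE j. 1 / real (j + 1) < x \<and> x \<le> 1 / real j))"

definition harmonic :: "nat \<Rightarrow> (nat \<times> nat) static_alg" where
  "harmonic k ws x =
     (harmonic_class k x,
      next_fit (filter (\<lambda>y. harmonic_class k y = harmonic_class k x) ws) x)"

definition num_bins :: "'b static_alg \<Rightarrow> real list \<Rightarrow> nat" where
  "num_bins A ws = card ((\<lambda>i. A (take i ws) (ws ! i)) ` {..<length ws})"

definition opt_bins :: "real list \<Rightarrow> nat" where
  "opt_bins ws =
     (LEAST n. \<exists>f. (\<forall>i<length ws. f i < n) \<and>
                   (\<forall>b<n. (\<Sum>i | i < length ws \<and> f i = b. ws ! i) \<le> 1))"

definition asymptotic_ratio :: "'b static_alg \<Rightarrow> real" where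
  "asymptotic_ratio A =
     Inf {\<rho>. \<exists>c. \<forall>ws. (\<forall>x\<in>set ws. 0 < x \<and> x \<le> 1) \<longrightarrow>
                       real (num_bins A ws) \<le> \<rho> * real (opt_bins ws) + c}"


section \<open>Dynamic online algorithms\<close>

text \<open>
  A dynamic algorithm sees the intervals it has received so far, in order of arrival, together with
  the machines on which it has placed them, and the arriving interval. It returns the open machine
  on which the arriving interval is placed, or \<open>None\<close> if a new machine is to be opened.
  End points of earlier intervals are only used to tell which of them have already departed. A
  machine is open as long as it has an active interval; closed machines are never used again.
\<close>

type_synonym history = "(interval \<times> nat) list"

definition machine_open :: "history \<Rightarrow> nat \<Rightarrow> nat \<Rightarrow> bool" where
  "machine_open H m t \<longleftrightarrow> (\<exists>J. (J, m) \<in> set H \<and> active J t)"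

definition machine_load :: "history \<Rightarrow> nat \<Rightarrow> nat \<Rightarrow> real" where
  "machine_load H m t = (\<Sum>(J, m') \<leftarrow> filter (\<lambda>(J, m'). m' = m \<and> active J t) H. width J)"

text \<open>
  Machines are named below in the order in which they are opened, so that the machine with the
  earliest opening time is the one with the least name.
\<close>

definition first_fit :: "history \<Rightarrow> interval \<Rightarrow> nat option" where
  "first_fit H I =
     (let M = {m. machine_open H m (start I) \<and> machine_load H m (start I) + width I \<le> 1}
      in if M = {} then None else Some (Min M))"

text \<open>
  The machine associated with a bin is the one that received the last item packed into that bin,
  unless this machine has been closed in the meantime.
\<close>

definition nonclairvoyant :: "'b static_alg \<Rightarrow> history \<Rightarrow> interval \<Rightarrow> nat option" where
  "nonclairvoyant A H I =
     (let ws = map (\<lambda>(J, m). width J) H;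
          P = {p. p < length H \<and> A (take p ws) (ws ! p) = A ws (width I)};
          m = snd (H ! Max P)
      in if P \<noteq> {} \<and> machine_open H m (start I) then Some m else None)"


section \<open>The Combined Algorithm\<close>

text \<open>
  In the following, \<open>V\<close> is the given average load and \<open>l i\<close> the given length of the interval at
  position \<open>i\<close> of the instance.
\<close>

definition eps :: "real \<Rightarrow> nat \<Rightarrow> real" where
  "eps V j = min 1 (real j / V)"

definition threshold :: "real \<Rightarrow> nat \<Rightarrow> real" where
  "threshold V j = min 1 (sqrt (V / real j))"

definition length_class :: "real \<Rightarrow> real \<Rightarrow> nat" where
  "length_class V x =
     (THE j. 1 \<le> j \<and> exp (\<Sum>i\<in>{1..<j}. eps V i) \<le> max 1 x \<and> max 1 x < exp (\<Sum>i\<in>{1..j}. eps V i))"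

definition class_load :: "real \<Rightarrow> interval list \<Rightarrow> (nat \<Rightarrow> real) \<Rightarrow> nat \<Rightarrow> real" where
  "class_load V Is l i =
     (\<Sum>p | p \<le> i \<and> length_class V (l p) = length_class V (l i) \<and> active (Is ! p) (start (Is ! i)).
        width (Is ! p))"

text \<open>
  The copy of an algorithm that handles the interval at position \<open>i\<close>: \<open>0\<close> stands for First-Fit
  and \<open>j \<ge> 1\<close> for the \<open>j\<close>-th copy of the dynamic non-clairvoyant algorithm.
\<close>

definition handler :: "real \<Rightarrow> interval list \<Rightarrow> (nat \<Rightarrow> real) \<Rightarrow> nat \<Rightarrow> nat" where
  "handler V Is l i =
     (let j = length_class V (l i) in if class_load V Is l i \<le> threshold V j then 0 else j)"

text \<open>
  The machines of the first \<open>n\<close> intervals. A machine is named after the position of the interval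
  for which it is opened. Hence the names are fresh, ordered by opening time, and different copies
  use disjoint sets of machines.
\<close>

primrec placements :: "'b static_alg \<Rightarrow> real \<Rightarrow> interval list \<Rightarrow> (nat \<Rightarrow> real) \<Rightarrow> nat \<Rightarrow> nat list" where
  "placements A V Is l 0 = []"
| "placements A V Is l (Suc i) =
     (let ms = placements A V Is l i;
          j = handler V Is l i;
          H = map (\<lambda>p. (Is ! p, ms ! p)) (filter (\<lambda>p. handler V Is l p = j) [0..<i]);
          r = (if j = 0 then first_fit H (Is ! i) else nonclairvoyant A H (Is ! i))
      in ms @ [case r of Some m \<Rightarrow> m | None \<Rightarrow> i])"

definition combined :: "'b static_alg \<Rightarrow> real \<Rightarrow> interval list \<Rightarrow> (nat \<Rightarrow> real) \<Rightarrow> nat \<Rightarrow> nat" where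
  "combined A V Is l i = placements A V Is l (length Is) ! i"

end

theory Submission
  imports Defs
begin

text \<open>
  At any time the First-Fit items have total size at most \<open>\<Sum>\<^sub>j q\<^sub>j\<close>, so First-Fit has
  \<open>O(1 + \<Sum>\<^sub>j q\<^sub>j)\<close> open machines. The \<open>j\<close>-th non-clairvoyant copy pays at most the maximum length of
  its class for every closed bin and one unit per time and item class for the bin in use. Lengths
  in class \<open>j\<close> differ by a factor of at most \<open>(1 + \<alpha>) * (1 + lam) * exp \<epsilon>\<^sub>j\<close>, so up to this factor the closed
  bins can be charged their minimum length, and this is at most the ratio of the static algorithm
  times the optimum: repeat the item sequence of each class as many times as its minimum length,
  and pack the \<open>y\<close>-th copy of an item as an optimal schedule does \<open>y\<close> steps after the arrival of the
  item. The copy is only used when the class load exceeds \<open>q\<^sub>j\<close>, so the time during which it is busy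
  is bounded both by \<open>T\<close> and by the demand of the class divided by \<open>q\<^sub>j\<close>. The choice of \<open>\<epsilon>\<^sub>j\<close> and
  \<open>q\<^sub>j\<close> makes all error terms \<open>O(T * sqrt ((1 + \<delta>) * v * ln \<mu>))\<close>.
\<close>

section \<open>Next-Fit and its classified variant\<close>

text \<open>The coefficient of the optimum has to be exact, so the loss inside a length class must
  not touch it. That loss, \<open>exp \<epsilon>\<^sub>j - 1 \<le> 2 * \<epsilon>\<^sub>j\<close>,
  is charged to the demand (size times duration), which is at most \<open>T * v\<close> and bounds
  the closed bins up to the factor 2 of Next-Fit; only the loss-free part is compared with the
  optimum. Let \<open>L\<close> be the logarithm of the largest length that can be given. With
  widths \<open>j / V\<close>, the range \<open>L\<close> is used up by about
  \<open>sqrt (V * L)\<close> classes, the widest having width about \<open>sqrt (L / V)\<close>;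
  both errors then balance at \<open>T * sqrt (v * L)\<close>. Beyond \<open>j = V\<close> widths
  are capped at 1 and the number of classes is of order \<open>L\<close>, possibly more than
  \<open>sqrt (V * L)\<close>; the thresholds \<open>sqrt (V / j)\<close> keep the sum over the
  classes at that order. A second obstacle is that the ratio of Harmonic is asymptotic: on a fixed
  sequence its additive constant is uncontrolled, hence a further blow-up of the sequence by a
  factor \<open>N\<close>. For uniform sizes a volume argument replaces this. The two cases differ
  only in how a bound \<open>P * OPT\<close> on the weighted closed bins is obtained.\<close>

definition closed_bins :: "real list \<Rightarrow> nat" where
  "closed_bins ws = fst (fold next_fit_step ws (0, 0))"

lemma closed_bins_Nil [simp]: "closed_bins [] = 0"
  by (simp add: closed_bins_def)

lemma next_fit_eq_closed_bins: "next_fit ws x = closed_bins (ws @ [x])"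
  by (simp add: next_fit_def closed_bins_def)

text \<open>Each step preserves the lexicographic order of the states (bins, level), shifted by
  \<open>d\<close> bins. \<open>0 \<le> l2\<close> matters when the trailing run catches up: it
  opens a bin at level \<open>x\<close> while the other run reaches \<open>l2 + x\<close>.\<close>

lemma fold_next_fit_mono:
  assumes "b1 + d < b2 \<or> (b1 + d = b2 \<and> l1 \<le> l2)" "0 \<le> l2" "\<forall>x\<in>set ws. 0 \<le> x"
  shows "fst (fold next_fit_step ws (b1, l1)) + d \<le> fst (fold next_fit_step ws (b2, l2))"
  using assms
proof (induction ws arbitrary: b1 l1 b2 l2)
  case Nil
  then show ?case by auto
next
  case (Cons x ws)
  obtain b1' l1' where 1: "next_fit_step x (b1, l1) = (b1', l1')" by fastforce
  obtain b2' l2' where 2: "next_fit_step x (b2, l2) = (b2', l2')" by fastforce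
  have "b1' + d < b2' \<or> (b1' + d = b2' \<and> l1' \<le> l2')" "0 \<le> l2'"
    using 1 2 Cons.prems by (auto split: if_splits)
  then have "fst (fold next_fit_step ws (b1', l1')) + d \<le> fst (fold next_fit_step ws (b2', l2'))"
    using Cons.prems(3) by (intro Cons.IH) auto
  then show ?case by (simp add: 1 2 del: next_fit_step.simps)
qed

lemma snd_fold_next_fit_nonneg:
  assumes "0 \<le> l" "\<forall>x\<in>set ws. 0 \<le> x"
  shows "0 \<le> snd (fold next_fit_step ws (b, l))"
  using assms by (induction ws arbitrary: b l) auto

text \<open>A run that inherits the state left by \<open>xs\<close> never falls behind a fresh run
  on \<open>ys\<close>. Counting closed bins instead of all bins is what makes the count
  superadditive: the active bin of \<open>xs\<close> may be shared with \<open>ys\<close>.\<close>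

lemma closed_bins_append:
  assumes "\<forall>x\<in>set xs. 0 \<le> x" "\<forall>x\<in>set ys. 0 \<le> x"
  shows "closed_bins xs + closed_bins ys \<le> closed_bins (xs @ ys)"
proof -
  obtain b l where bl: "fold next_fit_step xs (0, 0) = (b, l)" by fastforce
  then have "0 \<le> l" using snd_fold_next_fit_nonneg[of 0 xs 0] assms(1) by simp
  then have "fst (fold next_fit_step ys (0, 0)) + b \<le> fst (fold next_fit_step ys (b, l))"
    using assms by (intro fold_next_fit_mono) auto
  then show ?thesis by (simp add: closed_bins_def bl)
qed

lemma closed_bins_snoc:
  "closed_bins (xs @ [x]) = closed_bins xs \<or> closed_bins (xs @ [x]) = Suc (closed_bins xs)"
  by (cases "fold next_fit_step xs (0, 0)") (auto simp: closed_bins_def)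

lemma closed_bins_singleton: "x \<le> 1 \<Longrightarrow> closed_bins [x] = 0"
  by (simp add: closed_bins_def)

lemma closed_bins_le_twice_sum:
  assumes "\<forall>x\<in>set ws. 0 \<le> x"
  shows "real (closed_bins ws) \<le> 2 * sum_list ws"
proof -
  \<comment> \<open>Adding the level makes the bound inductive: closing a bin at level
    \<open>l\<close> because \<open>l + x > 1\<close> raises the left side by
    \<open>1 + x - l < 2 * x\<close>.\<close>
  have "real (fst (fold next_fit_step ws (0, 0))) + snd (fold next_fit_step ws (0, 0))
          \<le> 2 * sum_list ws"
    using assms
  proof (induction ws rule: rev_induct)
    case (snoc x ws)
    then show ?case by (cases "fold next_fit_step ws (0, 0)") auto
  qed simp
  then show ?thesis
    using snd_fold_next_fit_nonneg[of 0 ws 0] assms by (simp add: closed_bins_def)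
qed

text \<open>All levels are multiples of \<open>1 / g\<close>, so a bin is closed only when it is
  exactly full. No volume is wasted, which gives the optimum the coefficient 1 in the uniform
  case.\<close>

lemma closed_bins_uniform_le_sum:
  assumes "1 \<le> g" "\<forall>x\<in>set ws. x = 1 / real g"
  shows "real (closed_bins ws) \<le> sum_list ws"
proof -
  let ?s = "\<lambda>ws. fold next_fit_step ws (0, 0)"
  have "(\<exists>m\<le>g. snd (?s ws) = real m / real g)
        \<and> real (fst (?s ws)) + snd (?s ws) = sum_list ws"
    using assms(2)
  proof (induction ws rule: rev_induct)
    case Nil
    then show ?case by (auto intro: exI[of _ 0])
  next
    case (snoc x ws)
    obtain b l where bl: "?s ws = (b, l)" by fastforce
    from snoc bl obtain m where m: "m \<le> g" "l = real m / real g" "real b + l = sum_list ws"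
      and x: "x = 1 / real g" by auto
    have lx: "l + x = real (Suc m) / real g" using m x by (simp add: add_divide_distrib)
    show ?case
    proof (cases "Suc m \<le> g")
      case True
      then have "l + x \<le> 1" unfolding lx using assms(1) by (simp add: field_simps)
      then show ?thesis using True bl m lx by (auto intro: exI[of _ "Suc m"])
    next
      case False
      then have "m = g" using m by simp
      then have "l = 1" using m assms(1) by simp
      moreover have "0 < x" using x assms(1) by simp
      ultimately show ?thesis using bl m x assms(1) by (auto intro: exI[of _ 1])
    qed
  qed
  moreover have "0 \<le> snd (?s ws)"
    using assms by (intro snd_fold_next_fit_nonneg) auto
  ultimately show ?thesis by (simp add: closed_bins_def)
qed

text \<open>A constant \<open>cl\<close> gives Next-Fit itself, up to the names of the bins.\<close>

definition class_fit :: "(real \<Rightarrow> nat) \<Rightarrow> (nat \<times> nat) static_alg" where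
  "class_fit cl ws x = (cl x, next_fit (filter (\<lambda>y. cl y = cl x) ws) x)"

definition class_closed :: "(real \<Rightarrow> nat) \<Rightarrow> real list \<Rightarrow> nat \<Rightarrow> nat" where
  "class_closed cl ws c = closed_bins (filter (\<lambda>y. cl y = c) ws)"

lemma harmonic_eq_class_fit: "harmonic k = class_fit (harmonic_class k)"
  by (intro ext) (simp add: harmonic_def class_fit_def)

lemma class_fit_eq: "class_fit cl ws x = (cl x, class_closed cl (ws @ [x]) (cl x))"
  by (simp add: class_fit_def class_closed_def next_fit_eq_closed_bins)

lemma class_closed_append:
  assumes "\<forall>x\<in>set xs. 0 \<le> x" "\<forall>x\<in>set ys. 0 \<le> x"
  shows "class_closed cl xs c + class_closed cl ys c \<le> class_closed cl (xs @ ys) c"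
  using assms by (auto simp: class_closed_def intro!: closed_bins_append)

lemma class_closed_mono:
  assumes "\<forall>x\<in>set (xs @ ys). 0 \<le> x"
  shows "class_closed cl xs c \<le> class_closed cl (xs @ ys) c"
  using class_closed_append[of xs ys cl c] assms by simp

lemma sum_class_closed_le_twice_sum:
  assumes "finite C" "cl ` set ws \<subseteq> C" "\<forall>x\<in>set ws. 0 \<le> x"
  shows "real (\<Sum>c\<in>C. class_closed cl ws c) \<le> 2 * sum_list ws"
proof -
  have "(\<Sum>c\<in>C. sum_list (filter (\<lambda>y. cl y = c) ws)) = sum_list ws"
    using assms(2)
  proof (induction ws)
    case (Cons x ws)
    have "(\<Sum>c\<in>C. sum_list (filter (\<lambda>y. cl y = c) (x # ws)))
        = (\<Sum>c\<in>C. (if cl x = c then x else 0) + sum_list (filter (\<lambda>y. cl y = c) ws))"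
      by (intro sum.cong) auto
    then show ?case using Cons assms(1) by (simp add: sum.distrib)
  qed simp
  moreover have "real (\<Sum>c\<in>C. class_closed cl ws c)
      \<le> (\<Sum>c\<in>C. 2 * sum_list (filter (\<lambda>y. cl y = c) ws))"
    unfolding of_nat_sum class_closed_def
    by (intro sum_mono closed_bins_le_twice_sum) (use assms in auto)
  ultimately show ?thesis by (simp flip: sum_distrib_left)
qed

text \<open>One item closes at most one bin of its class, so the names used in a class form an
  initial segment; its last element is the active bin. Sizes at most 1 ensure that the first item of
  a class goes into bin 0.\<close>

lemma class_fit_bins:
  assumes "\<forall>x\<in>set ws. x \<le> 1"
  shows "(\<lambda>i. class_fit cl (take i ws) (ws ! i)) ` {..<length ws}
       = Sigma (cl ` set ws) (\<lambda>c. {..class_closed cl ws c})"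
  using assms
proof (induction ws rule: rev_induct)
  case (snoc x ws)
  have "(\<lambda>i. class_fit cl (take i (ws @ [x])) ((ws @ [x]) ! i)) ` {..<length (ws @ [x])}
      = insert (class_fit cl ws x) ((\<lambda>i. class_fit cl (take i ws) (ws ! i)) ` {..<length ws})"
    by (simp add: lessThan_Suc nth_append cong: image_cong_simp)
  also have "\<dots> = insert (class_fit cl ws x) (Sigma (cl ` set ws) (\<lambda>c. {..class_closed cl ws c}))"
    using snoc by simp
  also have "\<dots> = Sigma (cl ` set (ws @ [x])) (\<lambda>c. {..class_closed cl (ws @ [x]) c})"
  proof -
    have other: "class_closed cl (ws @ [x]) c = class_closed cl ws c" if "c \<noteq> cl x" for c
      using that by (simp add: class_closed_def)
    have own: "class_closed cl (ws @ [x]) (cl x) = class_closed cl ws (cl x)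
        \<or> class_closed cl (ws @ [x]) (cl x) = Suc (class_closed cl ws (cl x))"
      by (simp add: class_closed_def closed_bins_snoc)
    have first: "class_closed cl (ws @ [x]) (cl x) = 0" if "cl x \<notin> cl ` set ws"
    proof -
      have "filter (\<lambda>y. cl y = cl x) ws = []" using that by (auto simp: filter_empty_conv) (metis image_eqI)
      then show ?thesis using snoc.prems by (simp add: class_closed_def closed_bins_singleton)
    qed
    show ?thesis
    proof (cases "cl x \<in> cl ` set ws")
      case True
      then have "cl ` set (ws @ [x]) = cl ` set ws" by auto
      moreover have "{..class_closed cl (ws @ [x]) (cl x)}
          = insert (class_closed cl (ws @ [x]) (cl x)) {..class_closed cl ws (cl x)}"
        using own by (auto simp: atMost_Suc)
      ultimately show ?thesis using True other
        by (auto simp: class_fit_eq) (metis atMost_iff insert_iff)+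
    next
      case False
      then show ?thesis using other first by (auto simp: class_fit_eq) (metis image_eqI)+
    qed
  qed
  finally show ?case .
qed simp

lemma class_closed_eq_0: "c \<notin> cl ` set ws \<Longrightarrow> class_closed cl ws c = 0"
proof -
  assume "c \<notin> cl ` set ws"
  then have "filter (\<lambda>y. cl y = c) ws = []" by (auto simp: filter_empty_conv)
  then show ?thesis by (simp add: class_closed_def)
qed

lemma num_bins_class_fit:
  assumes "\<forall>x\<in>set ws. x \<le> 1"
  shows "num_bins (class_fit cl) ws = (\<Sum>c\<in>cl ` set ws. Suc (class_closed cl ws c))"
  by (simp add: num_bins_def class_fit_bins[OF assms])

lemma sum_class_closed_le_num_bins:
  assumes "\<forall>x\<in>set ws. x \<le> 1" "finite C"
  shows "(\<Sum>c\<in>C. class_closed cl ws c) \<le> num_bins (class_fit cl) ws"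
proof -
  have "(\<Sum>c\<in>C. class_closed cl ws c) \<le> (\<Sum>c\<in>C \<union> cl ` set ws. class_closed cl ws c)"
    using assms by (intro sum_mono2) auto
  also have "\<dots> = (\<Sum>c\<in>cl ` set ws. class_closed cl ws c)"
    using assms by (intro sum.mono_neutral_right) (auto intro: class_closed_eq_0)
  also have "\<dots> \<le> num_bins (class_fit cl) ws"
    unfolding num_bins_class_fit[OF assms(1)] by (intro sum_mono) simp
  finally show ?thesis .
qed

lemma harmonic_class_in:
  assumes "0 < x" "x \<le> 1" "1 \<le> k"
  shows "harmonic_class k x \<in> {1..k}"
proof (cases "x \<le> 1 / real k")
  case True
  then show ?thesis using assms by (simp add: harmonic_class_def)
next
  case False
  define j where "j = nat \<lfloor>1 / x\<rfloor>"
  have "1 \<le> 1 / x" using assms by simp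
  then have j: "real j \<le> 1 / x" "1 / x < real j + 1" "1 \<le> j"
    unfolding j_def by linarith+
  have *: "1 / real (j + 1) < x \<and> x \<le> 1 / real j"
    using j assms by (simp add: field_simps)
  have "i = j" if "1 / real (i + 1) < x \<and> x \<le> 1 / real i" for i
  proof -
    have "i \<noteq> 0" using that assms by (intro notI) simp
    then have "real i \<le> 1 / x" "1 / x < real i + 1" using that assms by (auto simp: field_simps)
    with j show ?thesis by linarith
  qed
  with * have "(THE j. 1 / real (j + 1) < x \<and> x \<le> 1 / real j) = j" by (intro the_equality)
  moreover have "j < k"
  proof -
    have "1 / x < real k" using False assms by (simp add: field_simps)
    with j show ?thesis by linarith
  qed
  ultimately show ?thesis using False j by (simp add: harmonic_class_def)
qed

section \<open>The asymptotic ratio of Harmonic\<close>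

text \<open>Frees packings from the encoding in \<open>opt_bins\<close>: items may be any distinct
  objects \<open>zs\<close> with sizes \<open>w\<close>, and bins may carry names from any finite
  set \<open>B\<close>.\<close>

lemma opt_bins_le:
  assumes "finite B" "distinct zs" "\<beta> ` set zs \<subseteq> B"
    and fits: "\<And>b. b \<in> B \<Longrightarrow> (\<Sum>z | z \<in> set zs \<and> \<beta> z = b. w z) \<le> (1::real)"
  shows "opt_bins (map w zs) \<le> card B"
proof -
  obtain \<phi> where \<phi>: "bij_betw \<phi> B {..<card B}"
    using assms(1) ex_bij_betw_finite_nat[of B] by (auto simp: atLeast0LessThan)
  let ?f = "\<lambda>i. \<phi> (\<beta> (zs ! i))"
  have "(\<forall>i<length (map w zs). ?f i < card B) \<and>
        (\<forall>b<card B. (\<Sum>i | i < length (map w zs) \<and> ?f i = b. map w zs ! i) \<le> 1)"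
  proof (intro conjI allI impI)
    fix i assume "i < length (map w zs)"
    then have "\<beta> (zs ! i) \<in> B" using assms(3) by auto
    then show "?f i < card B" using \<phi> by (auto simp: bij_betw_def)
  next
    fix b assume "b < card B"
    then obtain b' where b': "b' \<in> B" "\<phi> b' = b" using \<phi> by (metis bij_betw_imp_surj_on imageE lessThan_iff)
    have eq: "?f i = b \<longleftrightarrow> \<beta> (zs ! i) = b'" if "i < length zs" for i
    proof -
      have "\<beta> (zs ! i) \<in> B" using that assms(3) by auto
      then show ?thesis using \<phi> b' by (metis bij_betw_imp_inj_on inj_onD)
    qed
    have "(\<Sum>i | i < length (map w zs) \<and> ?f i = b. map w zs ! i)
        = (\<Sum>i | i < length zs \<and> \<beta> (zs ! i) = b'. w (zs ! i))"
      using eq by (intro sum.cong) auto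
    also have "\<dots> = (\<Sum>z | z \<in> set zs \<and> \<beta> z = b'. w z)"
      by (rule sum.reindex_bij_betw)
        (use assms(2) in \<open>auto simp: bij_betw_def inj_on_def nth_eq_iff_index_eq in_set_conv_nth image_iff\<close>)
    also have "\<dots> \<le> 1" using fits b' by simp
    finally show "(\<Sum>i | i < length (map w zs) \<and> ?f i = b. map w zs ! i) \<le> 1" .
  qed
  then show ?thesis unfolding opt_bins_def by (intro Least_le exI[of _ ?f])
qed

lemma sum_list_le_opt_bins:
  assumes "\<forall>x\<in>set ws. 0 < x \<and> x \<le> 1"
  shows "sum_list ws \<le> real (opt_bins ws)"
proof -
  let ?P = "\<lambda>n. \<exists>f. (\<forall>i<length ws. f i < n) \<and> (\<forall>b<n. (\<Sum>i | i < length ws \<and> f i = b. ws ! i) \<le> 1)"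
  have "?P (length ws)"
  proof (intro exI[of _ id] conjI allI impI)
    fix b assume b: "b < length ws"
    then have "{i. i < length ws \<and> id i = b} = {b}" by auto
    then show "(\<Sum>i | i < length ws \<and> id i = b. ws ! i) \<le> 1" using assms b by simp
  qed simp
  then have "?P (opt_bins ws)" unfolding opt_bins_def by (rule LeastI)
  then obtain f where f: "\<forall>i<length ws. f i < opt_bins ws"
    "\<forall>b<opt_bins ws. (\<Sum>i | i < length ws \<and> f i = b. ws ! i) \<le> 1" by blast
  have "sum_list ws = (\<Sum>i<length ws. ws ! i)" by (simp add: sum_list_sum_nth atLeast0LessThan)
  also have "\<dots> = (\<Sum>b<opt_bins ws. \<Sum>i | i \<in> {..<length ws} \<and> f i = b. ws ! i)"
    using f(1) by (intro sum.group[symmetric]) auto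
  also have "\<dots> \<le> (\<Sum>b<opt_bins ws. 1)" using f(2) by (intro sum_mono) auto
  finally show ?thesis by simp
qed

text \<open>Letting \<open>N\<close> tend to infinity removes the additive constant of the asymptotic ratio.\<close>

lemma asymptotic_ratio_harmonic_ge:
  assumes k: "1 \<le> k" and z: "0 < z" and "\<And>N. \<forall>x\<in>set (ws N). 0 < x \<and> x \<le> 1"
    and lower: "\<And>N. real N * y \<le> real (num_bins (harmonic k) (ws N))"
    and upper: "\<And>N. real (opt_bins (ws N)) \<le> real N * z"
  shows "y \<le> asymptotic_ratio (harmonic k) * z"
proof -
  let ?S = "{\<rho>. \<exists>c. \<forall>ws. (\<forall>x\<in>set ws. 0 < x \<and> x \<le> 1) \<longrightarrow>
                       real (num_bins (harmonic k) ws) \<le> \<rho> * real (opt_bins ws) + c}"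
  \<comment> \<open>An infimum of reals needs a nonempty set. Closed bins number at most twice the
    volume, and the active bins of the \<open>k\<close> classes form the additive constant.\<close>
  have "2 \<in> ?S"
  proof (intro CollectI exI[of _ "real k"] allI impI)
    fix ws :: "real list" assume ws: "\<forall>x\<in>set ws. 0 < x \<and> x \<le> 1"
    let ?cl = "harmonic_class k"
    have sub: "?cl ` set ws \<subseteq> {1..k}" using harmonic_class_in ws k by fast
    have "num_bins (harmonic k) ws = (\<Sum>c\<in>?cl ` set ws. Suc (class_closed ?cl ws c))"
      unfolding harmonic_eq_class_fit using ws by (intro num_bins_class_fit) auto
    also have "\<dots> = (\<Sum>c\<in>?cl ` set ws. class_closed ?cl ws c) + card (?cl ` set ws)"
      by (simp only: sum.distrib Suc_eq_plus1 card_eq_sum)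
    finally have "real (num_bins (harmonic k) ws)
        = real (\<Sum>c\<in>?cl ` set ws. class_closed ?cl ws c) + real (card (?cl ` set ws))" by simp
    moreover have "real (\<Sum>c\<in>?cl ` set ws. class_closed ?cl ws c) \<le> 2 * sum_list ws"
      using ws by (intro sum_class_closed_le_twice_sum) (auto intro: less_imp_le)
    moreover have "card (?cl ` set ws) \<le> k" using card_mono[OF _ sub] by simp
    ultimately show "real (num_bins (harmonic k) ws) \<le> 2 * real (opt_bins ws) + real k"
      using sum_list_le_opt_bins[OF ws] by simp
  qed
  moreover have "y / z \<le> \<rho>" if \<rho>: "\<rho> \<in> ?S" for \<rho>
  proof (rule ccontr)
    assume "\<not> y / z \<le> \<rho>"
    then have pos: "0 < y - \<rho> * z" using z by (simp add: field_simps)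
    obtain c where c: "\<forall>ws. (\<forall>x\<in>set ws. 0 < x \<and> x \<le> 1) \<longrightarrow>
                       real (num_bins (harmonic k) ws) \<le> \<rho> * real (opt_bins ws) + c"
      using \<rho> by blast
    \<comment> \<open>Needed for multiplying the upper bound on \<open>opt_bins\<close> by
      \<open>\<rho>\<close>. A negative \<open>\<rho>\<close> is refuted by many items of size 1:
      their volume makes \<open>opt_bins\<close> so large that the bin count would be
      negative.\<close>
    have "0 \<le> \<rho>"
    proof (rule ccontr)
      assume neg: "\<not> 0 \<le> \<rho>"
      obtain n :: nat where n: "c < real n * - \<rho>" using neg ex_less_of_nat_mult[of "- \<rho>" c] by auto
      let ?ws = "replicate n (1::real)"
      have "real n \<le> real (opt_bins ?ws)" using sum_list_le_opt_bins[of ?ws] by (simp add: sum_list_replicate)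
      then have "real n * - \<rho> \<le> real (opt_bins ?ws) * - \<rho>" using neg by (intro mult_right_mono) auto
      moreover have "real (num_bins (harmonic k) ?ws) \<le> \<rho> * real (opt_bins ?ws) + c" using c by simp
      ultimately show False using n by (simp add: algebra_simps)
    qed
    have "real N * (y - \<rho> * z) \<le> c" for N
    proof -
      have "real N * y \<le> \<rho> * real (opt_bins (ws N)) + c"
        using lower[of N] c assms(3)[of N] by (meson order_trans)
      also have "\<dots> \<le> \<rho> * (real N * z) + c" using upper[of N] \<open>0 \<le> \<rho>\<close> by (simp add: mult_left_mono)
      finally show ?thesis by (simp add: algebra_simps)
    qed
    moreover obtain N where "c < real N * (y - \<rho> * z)" using ex_less_of_nat_mult[OF pos] by blast
    ultimately show False by (metis not_le)
  qed
  ultimately have "y / z \<le> asymptotic_ratio (harmonic k)"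
    unfolding asymptotic_ratio_def by (intro cInf_greatest) blast+
  then show ?thesis using z by (simp add: field_simps)
qed

section \<open>Cost and demand\<close>

lemma card_mult_le_sum_fibres:
  fixes w :: "'a \<Rightarrow> real"
  assumes "finite P" "finite M" "\<And>p. p \<in> P \<Longrightarrow> 0 \<le> w p"
    and fibre: "\<And>m. m \<in> M \<Longrightarrow> c \<le> (\<Sum>p | p \<in> P \<and> f p = m. w p)"
  shows "real (card M) * c \<le> sum w P"
proof -
  have "real (card M) * c = (\<Sum>m\<in>M. c)" by simp
  also have "\<dots> \<le> (\<Sum>m\<in>M. \<Sum>p | p \<in> {p \<in> P. f p \<in> M} \<and> f p = m. w p)"
    by (intro sum_mono order_trans[OF fibre] eq_refl sum.cong) auto
  also have "\<dots> = sum w {p \<in> P. f p \<in> M}" using assms by (intro sum.group) auto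
  also have "\<dots> \<le> sum w P" using assms by (intro sum_mono2) auto
  finally show ?thesis .
qed

locale packing =
  fixes T :: nat and Is :: "interval list"
  assumes inst: "packing_instance T Is"
begin

abbreviation "n \<equiv> length Is"
abbreviation "act i t \<equiv> active (Is ! i) t"
abbreviation "s i \<equiv> start (Is ! i)"
abbreviation "e i \<equiv> finish (Is ! i)"
abbreviation "w i \<equiv> width (Is ! i)"
abbreviation "dur i \<equiv> e i - s i"

lemma s_mono: "i \<le> j \<Longrightarrow> j < n \<Longrightarrow> s i \<le> s j"
  using inst sorted_nth_mono[of "map start Is" i j] by (auto simp: packing_instance_def)

lemma item:
  assumes "i < n"
  shows "1 \<le> s i" "s i < e i" "e i \<le> T + 1" "0 < w i" "w i \<le> 1"
  using inst assms nth_mem[OF assms] by (auto simp: packing_instance_def)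

lemma T_pos: "1 \<le> T"
  using inst by (simp add: packing_instance_def)

lemma Is_nonempty: "0 < n"
  using inst T_pos by (fastforce simp: packing_instance_def)

lemma len_eq_dur: "i < n \<Longrightarrow> len (Is ! i) = real (dur i)"
  using item(2)[of i] by (simp add: len_def of_nat_diff)

lemma times_active: "i < n \<Longrightarrow> {t. act i t} = {s i..<e i}"
  by (auto simp: active_def)

lemma act_in_range: "i < n \<Longrightarrow> act i t \<Longrightarrow> t \<in> {1..T}"
  using item(1,3)[of i] by (auto simp: active_def)

text \<open>Cost as a set of machine-time pairs, so that it can be split over the copies and
  compared by injections and surjections. The label type is polymorphic because bins of the static
  algorithm later take the place of machines.\<close>

definition busy :: "(nat \<Rightarrow> 'm) \<Rightarrow> nat set \<Rightarrow> ('m \<times> nat) set" where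
  "busy f G = {(m, t). \<exists>i\<in>G. f i = m \<and> act i t}"

lemma busy_subset: "G \<subseteq> {..<n} \<Longrightarrow> busy f G \<subseteq> f ` G \<times> {1..T}"
  using act_in_range by (auto simp: busy_def subset_iff)

lemma finite_busy: "G \<subseteq> {..<n} \<Longrightarrow> finite (busy f G)"
  by (rule finite_subset[OF busy_subset]) (auto intro: finite_subset)

lemma cost_eq_card_busy: "cost Is f = card (busy f {..<n})"
proof -
  have "busy f {..<n} = Sigma (f ` {..<n}) (\<lambda>m. {t. \<exists>i<n. f i = m \<and> act i t})"
    by (auto simp: busy_def)
  moreover have "finite {t. \<exists>i<n. f i = m \<and> act i t}" for m
    by (rule finite_subset[of _ "{1..T}"]) (blast intro: act_in_range, simp)
  ultimately show ?thesis by (simp add: cost_def)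
qed

definition demand :: "nat set \<Rightarrow> real" where
  "demand G = (\<Sum>i\<in>G. real (dur i) * w i)"

lemma demand_mono: "G \<subseteq> H \<Longrightarrow> H \<subseteq> {..<n} \<Longrightarrow> demand G \<le> demand H"
  unfolding demand_def using item(4) finite_subset[of H "{..<n}"]
  by (intro sum_mono2) (auto simp: less_imp_le subset_iff)

lemma demand_nonneg: "G \<subseteq> {..<n} \<Longrightarrow> 0 \<le> demand G"
  using demand_mono[of "{}" G] by (simp add: demand_def)

lemma demand_eq_sum_load:
  assumes "G \<subseteq> {..<n}"
  shows "demand G = (\<Sum>t=1..T. \<Sum>i | i \<in> G \<and> act i t. w i)"
proof -
  have fin: "finite G" using assms finite_subset by blast
  have "demand G = (\<Sum>i\<in>G. \<Sum>t | t \<in> {1..T} \<and> act i t. w i)"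
  proof (unfold demand_def, intro sum.cong refl)
    fix i assume "i \<in> G"
    then have "i < n" using assms by auto
    then have "{t. t \<in> {1..T} \<and> act i t} = {s i..<e i}"
      using times_active act_in_range by blast
    then show "real (dur i) * w i = (\<Sum>t | t \<in> {1..T} \<and> act i t. w i)" by simp
  qed
  also have "\<dots> = (\<Sum>t=1..T. \<Sum>i | i \<in> G \<and> act i t. w i)"
    using fin by (intro sum.swap_restrict) auto
  finally show ?thesis .
qed

lemma demand_le_avg_load: "demand {..<n} \<le> real T * avg_load T Is"
proof -
  have "demand {..<n} \<le> (\<Sum>t=1..T. of_int \<lceil>\<Sum>i | i < n \<and> act i t. w i\<rceil>)"
    unfolding demand_eq_sum_load[OF order_refl] by (intro sum_mono) (simp add: le_of_int_ceiling)
  then show ?thesis using T_pos by (simp add: avg_load_def)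
qed

text \<open>Every step has an active interval, and the ceiling lifts its load to 1. This makes
  \<open>V\<close> positive and lets additive terms of order \<open>T\<close> disappear in the error
  term.\<close>

lemma avg_load_ge_1: "1 \<le> avg_load T Is"
proof -
  have "(\<Sum>t=1..T. 1) \<le> (\<Sum>t=1..T. real_of_int \<lceil>\<Sum>i | i < n \<and> act i t. w i\<rceil>)"
  proof (intro sum_mono)
    fix t assume "t \<in> {1..T}"
    then have "\<exists>I\<in>set Is. active I t" using inst unfolding packing_instance_def by blast
    then obtain i where "i < n" "act i t" by (auto simp: in_set_conv_nth)
    then have "0 < (\<Sum>i | i < n \<and> act i t. w i)"
      using item(4) by (intro sum_pos2[of _ i]) (auto simp: less_imp_le)
    then show "1 \<le> real_of_int \<lceil>\<Sum>i | i < n \<and> act i t. w i\<rceil>"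
      by (simp add: one_le_ceiling)
  qed
  then show ?thesis using T_pos by (simp add: avg_load_def)
qed

lemma optimal_schedule: obtains f where "feasible Is f" "cost Is f = opt_cost Is"
proof -
  have "feasible Is id"
    unfolding feasible_def
  proof (intro allI)
    fix m t
    have "(\<Sum>i | i < n \<and> id i = m \<and> act i t. w i) \<le> (\<Sum>i | i < n \<and> i = m. w i)"
      using item(4) by (intro sum_mono2) (auto simp: less_imp_le)
    also have "\<dots> \<le> 1"
    proof (cases "m < n")
      case True
      then have "{i. i < n \<and> i = m} = {m}" by auto
      then show ?thesis using item(5)[OF True] by simp
    next
      case False
      then have none: "{i. i < n \<and> i = m} = {}" by auto
      show ?thesis unfolding none by simp
    qed
    finally show "(\<Sum>i | i < n \<and> id i = m \<and> act i t. w i) \<le> 1" .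
  qed
  then have "\<exists>c f. feasible Is f \<and> cost Is f = c" by blast
  then have "\<exists>f. feasible Is f \<and> cost Is f = opt_cost Is" unfolding opt_cost_def by (rule LeastI_ex)
  then show ?thesis using that by blast
qed

lemma demand_le_opt: "demand {..<n} \<le> real (opt_cost Is)"
proof -
  obtain f where f: "feasible Is f" "cost Is f = opt_cost Is" by (rule optimal_schedule)
  have load: "(\<Sum>i | i < n \<and> act i t. w i) \<le> real (card {m. (m, t) \<in> busy f {..<n}})" for t
  proof -
    let ?M = "{m. (m, t) \<in> busy f {..<n}}"
    have M: "?M = f ` {i. i < n \<and> act i t}" by (auto simp: busy_def)
    have "(\<Sum>i | i < n \<and> act i t. w i) = (\<Sum>m\<in>?M. \<Sum>i | i \<in> {i. i < n \<and> act i t} \<and> f i = m. w i)"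
      unfolding M by (intro sum.group[symmetric]) auto
    also have "\<dots> \<le> (\<Sum>m\<in>?M. 1)"
      using f(1) by (intro sum_mono) (simp add: feasible_def conj_commute conj_left_commute)
    finally show ?thesis by simp
  qed
  have "busy f {..<n} = (\<lambda>(t, m). (m, t)) ` Sigma {1..T} (\<lambda>t. {m. (m, t) \<in> busy f {..<n}})"
    using busy_subset[OF order_refl, of f] by force
  moreover have "inj_on (\<lambda>(t, m). (m, t)) X" for X :: "(nat \<times> nat) set" by (auto simp: inj_on_def)
  ultimately have "card (busy f {..<n}) = card (Sigma {1..T} (\<lambda>t. {m. (m, t) \<in> busy f {..<n}}))"
    by (metis card_image)
  also have "\<dots> = (\<Sum>t=1..T. card {m. (m, t) \<in> busy f {..<n}})"
    by (intro card_SigmaI) (auto intro: finite_subset[of _ "f ` {..<n}"] simp: busy_def)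
  finally have "real (opt_cost Is) = (\<Sum>t=1..T. real (card {m. (m, t) \<in> busy f {..<n}}))"
    unfolding f(2)[symmetric] cost_eq_card_busy by simp
  moreover have "demand {..<n} \<le> (\<Sum>t=1..T. real (card {m. (m, t) \<in> busy f {..<n}}))"
    unfolding demand_eq_sum_load[OF order_refl] using load by (intro sum_mono) simp
  ultimately show ?thesis by simp
qed

section \<open>Dynamic First-Fit\<close>

text \<open>The history that the copy in charge of \<open>G\<close> has seen before item
  \<open>i\<close>, read off the finished assignment \<open>f\<close>; this is legitimate because
  placements are never revised.\<close>

definition hist :: "(nat \<Rightarrow> nat) \<Rightarrow> nat set \<Rightarrow> nat \<Rightarrow> history" where
  "hist f G i = map (\<lambda>p. (Is ! p, f p)) (filter (\<lambda>p. p \<in> G) [0..<i])"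

lemma machine_open_hist:
  "machine_open (hist f G i) m t \<longleftrightarrow> (\<exists>p\<in>G. p < i \<and> f p = m \<and> act p t)"
  by (auto simp: machine_open_def hist_def)

lemma machine_load_hist:
  "machine_load (hist f G i) m t = (\<Sum>p | p \<in> {p \<in> G. p < i \<and> act p t} \<and> f p = m. w p)"
proof -
  have "machine_load (hist f G i) m t
      = sum_list (map w (filter (\<lambda>p. p \<in> G \<and> f p = m \<and> act p t) [0..<i]))"
    by (simp add: machine_load_def hist_def filter_map o_def conj_commute)
  also have "\<dots> = (\<Sum>p | p \<in> {p \<in> G. p < i \<and> act p t} \<and> f p = m. w p)"
    by (subst sum_list_distinct_conv_sum_set) (auto intro!: sum.cong)
  finally show ?thesis .
qed

context
  fixes F :: "nat set" and f :: "nat \<Rightarrow> nat" and Q :: real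
  assumes F: "F \<subseteq> {..<n}"
    and ff: "\<And>i. i \<in> F \<Longrightarrow>
      f i = (case first_fit (hist f F i) (Is ! i) of Some m \<Rightarrow> m | None \<Rightarrow> i)"
    and Q: "\<And>t. (\<Sum>i | i \<in> F \<and> act i t. w i) \<le> Q"
begin

lemma first_fit_choice:
  assumes "i \<in> F"
  defines "M \<equiv> {m. machine_open (hist f F i) m (s i) \<and> machine_load (hist f F i) m (s i) + w i \<le> 1}"
  shows "M = {} \<Longrightarrow> f i = i" "M \<noteq> {} \<Longrightarrow> f i = Min M" "finite M"
proof -
  show "M = {} \<Longrightarrow> f i = i" "M \<noteq> {} \<Longrightarrow> f i = Min M"
    using ff[OF assms(1)] by (auto simp: first_fit_def M_def Let_def)
  show "finite M"
    by (rule finite_subset[of _ "f ` {..<i}"]) (auto simp: M_def machine_open_hist)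
qed

lemma first_fit_open:
  assumes "i \<in> F" "f i \<noteq> i"
  shows "\<exists>p\<in>F. p < i \<and> f p = f i \<and> act p (s i)"
proof -
  let ?M = "{m. machine_open (hist f F i) m (s i) \<and> machine_load (hist f F i) m (s i) + w i \<le> 1}"
  have "?M \<noteq> {}" using first_fit_choice(1)[OF assms(1)] assms(2) by blast
  then have "f i \<in> ?M"
    using first_fit_choice(2,3)[OF assms(1)] Min_in[of ?M] by presburger
  then show ?thesis by (simp add: machine_open_hist)
qed

text \<open>A machine bears the position of the item that opened it, and that item lies on it.
  Comparing names with positions therefore compares opening times with arrivals.\<close>

lemma first_fit_name: "i \<in> F \<Longrightarrow> f i \<in> F \<and> f (f i) = f i \<and> f i \<le> i"
proof (induction i rule: less_induct)
  case (less i)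
  show ?case
  proof (cases "f i = i")
    case False
    then obtain p where "p \<in> F" "p < i" "f p = f i" using first_fit_open less.prems by blast
    then show ?thesis using less.IH[of p] by auto
  qed (use less in auto)
qed

text \<open>If \<open>p\<close> arrived after \<open>i\<close>, it found machine \<open>m\<close>
  open, so an earlier item of \<open>m\<close> was active at that moment. Descending in this way
  must reach an item before \<open>i\<close>: it cannot stop at the opener, whose position
  \<open>m\<close> is below \<open>i\<close>.\<close>

lemma first_fit_stays_open:
  assumes "i \<in> F" "p \<in> F" "f p = m" "act p t" "s i \<le> t" "m < i"
  shows "\<exists>q\<in>F. q < i \<and> f q = m \<and> act q (s i)"
  using assms(2-5)
proof (induction p arbitrary: t rule: less_induct)
  case (less p)
  show ?case
  proof (cases "p < i")
    case True
    then have "act p (s i)" using s_mono[of p i] assms(1) F less.prems by (auto simp: active_def)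
    then show ?thesis using True less.prems by blast
  next
    case False
    then have "f p \<noteq> p" using less.prems assms(6) by auto
    then obtain q where "q \<in> F" "q < p" "f q = m" "act q (s p)"
      using first_fit_open[of p] less.prems by auto
    moreover have "s i \<le> s p" using False s_mono[of i p] less.prems F by auto
    ultimately show ?thesis using less.IH[of q "s p"] by blast
  qed
qed

lemma first_fit_rejects:
  assumes "i \<in> F" "m < f i" "\<exists>q\<in>F. q < i \<and> f q = m \<and> act q (s i)"
  shows "1 < machine_load (hist f F i) m (s i) + w i"
proof (rule ccontr)
  let ?M = "{m. machine_open (hist f F i) m (s i) \<and> machine_load (hist f F i) m (s i) + w i \<le> 1}"
  assume "\<not> ?thesis"
  then have m: "m \<in> ?M" using assms by (simp add: machine_open_hist)
  then have "?M \<noteq> {}" by blast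
  then have "f i = Min ?M" by (rule first_fit_choice(2)[OF assms(1)])
  also have "\<dots> \<le> m" by (rule Min_le[OF first_fit_choice(3)[OF assms(1)] m])
  finally show False using assms(2) by simp
qed

text \<open>Consider the last machine that holds an item of size at most \<open>1/2\<close>. When this item arrived,
  all machines opened earlier were more than half full; all machines opened later hold items of
  size more than \<open>1/2\<close> only.\<close>

lemma first_fit_machines: "real (card (f ` {i \<in> F. act i t})) \<le> 4 * Q + 1"
proof -
  have finF: "finite F" using F finite_subset by blast
  have w_nonneg: "0 \<le> w i" if "i \<in> F" for i using item(4)[of i] F that by auto
  let ?O = "f ` {i \<in> F. act i t}"
  define small where "small = f ` {i \<in> F. act i t \<and> w i \<le> 1/2}"
  have finO: "finite ?O" "finite small" "small \<subseteq> ?O" using finF by (auto simp: small_def)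
  \<comment> \<open>Machines are split by content: those in \<open>?O - small\<close> hold an active
    item larger than 1/2. They contribute \<open>2 * Q\<close>, and those in \<open>small\<close>
    contribute \<open>2 * Q + 1\<close>, the 1 being the machine opened last among them.\<close>
  have "real (card (?O - small)) * (1/2) \<le> sum w {i \<in> F. act i t}"
  proof (rule card_mult_le_sum_fibres)
    fix m assume m: "m \<in> ?O - small"
    then obtain i where i: "i \<in> F" "act i t" "f i = m" by auto
    have "\<not> w i \<le> 1/2"
    proof
      assume "w i \<le> 1/2"
      then have "m \<in> small" using i unfolding small_def by blast
      then show False using m by simp
    qed
    then have "1/2 \<le> w i" by simp
    also have "\<dots> \<le> (\<Sum>p | p \<in> {i \<in> F. act i t} \<and> f p = m. w p)"
      using i finF w_nonneg by (intro member_le_sum) auto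
    finally show "1/2 \<le> (\<Sum>p | p \<in> {i \<in> F. act i t} \<and> f p = m. w p)" .
  qed (use finF w_nonneg in auto)
  then have big: "real (card (?O - small)) \<le> 2 * Q" using Q[of t] by simp
  have "real (card small) \<le> 2 * Q + 1"
  proof (cases "small = {}")
    case True
    have "0 \<le> (\<Sum>i | i \<in> F \<and> act i t. w i)" using w_nonneg by (intro sum_nonneg) simp
    then have "0 \<le> Q" using Q[of t] by linarith
    then show ?thesis using True by simp
  next
    case False
    define m where "m = Max small"
    have "m \<in> small" using False finO by (simp add: m_def)
    then obtain i where i: "i \<in> F" "act i t" "w i \<le> 1/2" "f i = m" by (auto simp: small_def)
    have "real (card (small - {m})) * (1/2) \<le> sum w {p \<in> F. p < i \<and> act p (s i)}"
    proof (rule card_mult_le_sum_fibres)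
      fix m' assume m': "m' \<in> small - {m}"
      then have "m' \<le> m" using finO by (simp add: m_def)
      then have less: "m' < m" using m' by simp
      obtain p where p: "p \<in> F" "act p t" "f p = m'" using m' by (auto simp: small_def)
      have "m \<le> i" using first_fit_name i by blast
      then have "\<exists>q\<in>F. q < i \<and> f q = m' \<and> act q (s i)"
        using first_fit_stays_open[of i p m' t] i p less by (auto simp: active_def)
      then have "1 < machine_load (hist f F i) m' (s i) + w i"
        using first_fit_rejects[of i m'] i less by blast
      then show "1/2 \<le> (\<Sum>q | q \<in> {p \<in> F. p < i \<and> act p (s i)} \<and> f q = m'. w q)"
        using i(3) unfolding machine_load_hist by linarith
    qed (use finF finO w_nonneg in auto)
    also have "\<dots> \<le> (\<Sum>p | p \<in> F \<and> act p (s i). w p)"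
      using finF w_nonneg by (intro sum_mono2) auto
    also have "\<dots> \<le> Q" by (rule Q)
    finally have "real (card (small - {m})) \<le> 2 * Q" by simp
    moreover have "card small = Suc (card (small - {m}))"
      using card.remove[OF finO(2) \<open>m \<in> small\<close>] .
    ultimately show ?thesis by simp
  qed
  moreover have "card ?O = card (?O - small) + card small"
    using finO card_mono[of ?O small] by (simp add: card_Diff_subset)
  ultimately show ?thesis using big by simp
qed

lemma first_fit_busy: "real (card (busy f F)) \<le> real T * (4 * Q + 1)"
proof -
  have finF: "finite F" using F finite_subset by blast
  have "busy f F \<subseteq> (\<Union>t\<in>{1..T}. (\<lambda>m. (m, t)) ` (f ` {i \<in> F. act i t}))"
    using busy_subset[OF F, of f] by (fastforce simp: busy_def)
  then have "card (busy f F) \<le> card (\<Union>t\<in>{1..T}. (\<lambda>m. (m, t)) ` (f ` {i \<in> F. act i t}))"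
    using finF by (intro card_mono) auto
  also have "\<dots> \<le> (\<Sum>t=1..T. card ((\<lambda>m. (m, t)) ` (f ` {i \<in> F. act i t})))"
    by (intro card_UN_le) simp
  also have "\<dots> \<le> (\<Sum>t=1..T. card (f ` {i \<in> F. act i t}))"
    using finF by (intro sum_mono card_image_le) auto
  finally have "real (card (busy f F)) \<le> (\<Sum>t=1..T. real (card (f ` {i \<in> F. act i t})))"
    by (simp flip: of_nat_sum)
  also have "\<dots> \<le> (\<Sum>t=1..T. 4 * Q + 1)" by (intro sum_mono first_fit_machines)
  finally show ?thesis by simp
qed

end

end

section \<open>The threshold parameters\<close>

lemma sum_inverse_sqrt_le: "(\<Sum>j=1..J. 1 / sqrt (real j)) \<le> 2 * sqrt (real J)"
proof (induction J)
  case (Suc J)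
  let ?a = "sqrt (real J)" and ?b = "sqrt (real (Suc J))"
  have b: "0 < ?b" by simp
  have "(?b - ?a)\<^sup>2 \<ge> 0" by simp
  then have "2 * (?a * ?b) \<le> ?a\<^sup>2 + ?b\<^sup>2" by (simp add: power2_eq_square algebra_simps)
  also have "\<dots> = 2 * ?b\<^sup>2 - 1" by (simp add: real_sqrt_pow2)
  finally have "1 \<le> (2 * ?b - 2 * ?a) * ?b" by (simp add: power2_eq_square algebra_simps)
  then have "1 / ?b \<le> 2 * ?b - 2 * ?a" using b by (simp add: field_simps)
  then show ?case using Suc by simp
qed simp

lemma half_le_ln2: "1/2 \<le> ln (2::real)"
proof -
  have "ln (1/2) \<le> 1/2 - (1::real)" by (rule ln_le_minus_one) simp
  then show ?thesis by (simp add: ln_div)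
qed

text \<open>The function \<open>sqrt (ln x) / x\<close> is nonincreasing from 2 on. With
  \<open>y = z * x\<close> this amounts to \<open>ln z + ln x \<le> z\<^sup>2 * ln x\<close>, which
  follows from \<open>ln z \<le> z - 1\<close> and \<open>(z + 1) * ln x \<ge> 1\<close>.\<close>

lemma mult_sqrt_ln_le:
  fixes x y :: real
  assumes "2 \<le> x" "x \<le> y"
  shows "x * sqrt (ln y) \<le> y * sqrt (ln x)"
proof -
  define z where "z = y / x"
  have z: "1 \<le> z" "y = z * x" using assms by (auto simp: z_def)
  have "ln 2 \<le> ln x" using assms by simp
  with half_le_ln2 have lnx: "1/2 \<le> ln x" by linarith
  have "ln y = ln z + ln x" using z assms by (simp add: ln_mult)
  also have "\<dots> \<le> (z - 1) + ln x" using z ln_le_minus_one[of z] by simp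
  also have "\<dots> \<le> (z - 1) * ((z + 1) * ln x) + ln x"
  proof -
    have "1 \<le> (z + 1) * ln x" using mult_mono[of 2 "z+1" "1/2" "ln x"] z lnx by simp
    then have "(z - 1) * 1 \<le> (z - 1) * ((z + 1) * ln x)" using z by (intro mult_left_mono) auto
    then show ?thesis by simp
  qed
  also have "\<dots> = z\<^sup>2 * ln x" by (simp add: power2_eq_square algebra_simps)
  finally have "sqrt (ln y) \<le> sqrt (z\<^sup>2 * ln x)" by simp
  also have "\<dots> = z * sqrt (ln x)" using z by (simp add: real_sqrt_mult)
  finally show ?thesis using assms z by (simp add: mult_left_mono algebra_simps)
qed

lemma exp_le_affine:
  fixes x :: real
  assumes "0 \<le> x" "x \<le> 1"
  shows "exp x \<le> 1 + 2 * x"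
proof -
  have "exp x \<le> 1 + x + x\<^sup>2" using assms by (rule exp_bound)
  also have "x\<^sup>2 \<le> x" using assms by (simp add: power2_eq_square mult_left_le)
  finally show ?thesis by simp
qed

text \<open>Bounds the number \<open>J\<close> of classes that fit into total width
  \<open>L\<close>. For \<open>J \<le> V\<close> the widths are \<open>i / V\<close> and sum to
  \<open>J * (J - 1) / (2 * V)\<close>; for \<open>J > V\<close> each width is at least
  \<open>i / J\<close>, so they sum to at least \<open>(J - 1) / 2\<close>. The assumption
  \<open>1/2 \<le> L\<close> absorbs the lower-order terms.\<close>

lemma last_class_cases:
  assumes V: "0 < V" and L: "1/2 \<le> L" and J: "1 \<le> J" and sum: "(\<Sum>i\<in>{1..<J}. eps V i) \<le> L"
  obtains "real J \<le> V" "(real J)\<^sup>2 \<le> 4 * V * L" | "V < real J" "real J \<le> 4 * L"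
proof -
  have gauss: "(\<Sum>i\<in>{1..<J}. real i) = real J * (real J - 1) / 2"
    using J by (induction J rule: dec_induct) (auto simp: field_simps)
  show ?thesis
  proof (cases "real J \<le> V")
    case True
    have "real J * (real J - 1) / 2 / V = (\<Sum>i\<in>{1..<J}. real i / V)"
      unfolding sum_divide_distrib[symmetric] gauss ..
    also have "\<dots> = (\<Sum>i\<in>{1..<J}. eps V i)"
      using True V by (intro sum.cong) (auto simp: eps_def min_def field_simps)
    finally have 1: "real J * (real J - 1) \<le> 2 * V * L" using sum V by (simp add: field_simps)
    have "(real J)\<^sup>2 \<le> 4 * V * L"
    proof (cases "J = 1")
      case True
      then have "1 * (1/2) \<le> V * L" using \<open>real J \<le> V\<close> L by (intro mult_mono) auto
      then show ?thesis using True by simp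
    next
      case False
      then have "real J * 2 \<le> real J * real J" using J by (intro mult_left_mono) auto
      then show ?thesis using 1 by (simp add: power2_eq_square algebra_simps)
    qed
    then show ?thesis using True that by blast
  next
    case False
    have "real J * (real J - 1) / 2 / real J = (\<Sum>i\<in>{1..<J}. real i / real J)"
      unfolding sum_divide_distrib[symmetric] gauss ..
    also have "\<dots> \<le> (\<Sum>i\<in>{1..<J}. eps V i)"
      using False V by (intro sum_mono) (auto simp: eps_def frac_le)
    finally have "(real J - 1) / 2 \<le> L" using sum J by simp
    then have "real J \<le> 4 * L" using L by simp
    then show ?thesis using False that by simp
  qed
qed

lemma eps_le:
  assumes V: "0 < V" and L: "1/2 \<le> L" and sum: "(\<Sum>i\<in>{1..<J}. eps V i) \<le> L"
    and j: "j \<in> {1..J}"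
  shows "eps V j \<le> 2 * sqrt (L / V)"
proof -
  from j have "1 \<le> J" by simp
  from V L this sum show ?thesis
  proof (cases rule: last_class_cases)
    case 1
    have "eps V j \<le> real J / V" using j V by (auto simp: eps_def min_le_iff_disj divide_right_mono)
    also have "\<dots> \<le> sqrt (4 * (L / V))"
      using 1 V by (intro real_le_rsqrt) (simp add: field_simps power2_eq_square)
    finally show ?thesis by (simp only: real_sqrt_mult real_sqrt_four)
  next
    case 2
    have "1 \<le> sqrt (4 * (L / V))" using 2 V by (simp add: field_simps)
    then have "eps V j \<le> sqrt (4 * (L / V))" by (auto simp only: eps_def min_le_iff_disj)
    then show ?thesis by (simp only: real_sqrt_mult real_sqrt_four)
  qed
qed

text \<open>A threshold below 1 means \<open>V < j \<le> J\<close>, which leaves only the regime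
  \<open>J \<le> 4 * L\<close>.\<close>

lemma inverse_threshold_le:
  assumes V: "0 < V" and L: "1/2 \<le> L" and sum: "(\<Sum>i\<in>{1..<J}. eps V i) \<le> L"
    and j: "j \<in> {1..J}" and q: "threshold V j < 1"
  shows "1 / threshold V j \<le> 2 * sqrt (L / V)"
proof -
  have "sqrt (V / real j) < 1" using q by (simp add: threshold_def min_def split: if_splits)
  then have "V < real j" using j by (simp add: field_simps)
  from j have "1 \<le> J" by simp
  from V L this sum show ?thesis
  proof (cases rule: last_class_cases)
    case 1
    then show ?thesis using \<open>V < real j\<close> j by simp
  next
    case 2
    have "threshold V j = sqrt (V / real j)" using q by (auto simp: threshold_def)
    then have "1 / threshold V j = sqrt (real j / V)" by (simp add: real_sqrt_divide)
    also have "\<dots> \<le> sqrt (4 * (L / V))" using 2 j V by (simp add: field_simps)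
    finally show ?thesis by (simp only: real_sqrt_mult real_sqrt_four)
  qed
qed

text \<open>With \<open>J \<le> V\<close> classes, bounding every threshold by 1 suffices. With more
  classes the decay \<open>1 / sqrt j\<close> brings the sum down to \<open>2 * sqrt (V * J)\<close>
  with \<open>J \<le> 4 * L\<close>. The sum bounds the load of First-Fit and, times
  \<open>T\<close>, the busy times of copies with threshold 1.\<close>

lemma sum_threshold_le:
  assumes V: "0 < V" and L: "1/2 \<le> L" and sum: "(\<Sum>i\<in>{1..<J}. eps V i) \<le> L"
    and J: "1 \<le> J"
  shows "(\<Sum>j=1..J. threshold V j) \<le> 4 * sqrt (V * L)"
  using V L J sum
proof (cases rule: last_class_cases)
  case 1
  have "(\<Sum>j=1..J. threshold V j) \<le> (\<Sum>j=1..J. 1)" by (intro sum_mono) (simp add: threshold_def)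
  also have "\<dots> \<le> sqrt (4 * (V * L))" using 1 by (auto intro: real_le_rsqrt simp: algebra_simps)
  also have "\<dots> \<le> 4 * sqrt (V * L)" using V L by (simp add: real_sqrt_mult)
  finally show ?thesis .
next
  case 2
  have "(\<Sum>j=1..J. threshold V j) \<le> (\<Sum>j=1..J. sqrt V * (1 / sqrt (real j)))"
    by (intro sum_mono) (simp add: threshold_def real_sqrt_divide)
  also have "\<dots> \<le> sqrt V * (2 * sqrt (real J))"
    unfolding sum_distrib_left[symmetric] using V by (intro mult_left_mono sum_inverse_sqrt_le) auto
  also have "\<dots> \<le> sqrt V * (2 * sqrt (4 * L))" using V 2 by (intro mult_left_mono) auto
  also have "\<dots> = 4 * sqrt (V * L)" by (simp add: real_sqrt_mult)
  finally show ?thesis .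
qed

text \<open>The widths are nondecreasing in \<open>j\<close>, so their partial sums grow at least
  linearly and the classes cover all lengths from 1 on. This gives a meaning to the definite
  description in \<open>length_class\<close>.\<close>

lemma exists_unique_eps_interval:
  assumes V: "0 < V" and x: "1 \<le> x"
  shows "\<exists>!j. 1 \<le> j \<and> exp (\<Sum>i\<in>{1..<j}. eps V i) \<le> x \<and> x < exp (\<Sum>i\<in>{1..j}. eps V i)"
proof -
  let ?S = "\<lambda>j. \<Sum>i\<in>{1..j}. eps V i"
  have pos: "0 \<le> eps V i" for i using V by (simp add: eps_def)
  have upt: "{1..<j} = {1..j - 1}" if "1 \<le> j" for j :: nat using that by auto
  have mono: "?S i \<le> ?S j" if "i \<le> j" for i j using that pos by (intro sum_mono2) auto
  have "\<exists>j. ln x < ?S j"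
  proof -
    have c: "0 < eps V 1" using V by (simp add: eps_def)
    obtain m where "ln x < real m * eps V 1" using ex_less_of_nat_mult[OF c] by blast
    also have "\<dots> = (\<Sum>i\<in>{1..m}. eps V 1)" by simp
    also have "\<dots> \<le> ?S m"
      unfolding eps_def using V by (intro sum_mono min.mono divide_right_mono) auto
    finally show ?thesis by blast
  qed
  then have ex: "\<exists>j. x < exp (?S j)" using x by (metis exp_less_mono exp_ln less_le_trans zero_less_one)
  define j where "j = (LEAST j. x < exp (?S j))"
  have j: "x < exp (?S j)" unfolding j_def by (rule LeastI_ex[OF ex])
  have "j \<noteq> 0" using j x by (intro notI) simp
  moreover have "\<not> x < exp (?S (j - 1))" using \<open>j \<noteq> 0\<close> unfolding j_def by (intro not_less_Least) simp
  ultimately have ok: "1 \<le> j \<and> exp (\<Sum>i\<in>{1..<j}. eps V i) \<le> x \<and> x < exp (?S j)"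
    using j upt[of j] by (metis One_nat_def Suc_leI not_less neq0_conv)
  have less: False if "i < i'" "x < exp (?S i)" "1 \<le> i'" "exp (\<Sum>i\<in>{1..<i'}. eps V i) \<le> x" for i i'
  proof -
    have "?S i \<le> ?S (i' - 1)" using that by (intro mono) simp
    then have "exp (?S i) \<le> exp (?S (i' - 1))" by simp
    then show False using that(2,4) unfolding upt[OF that(3)] by linarith
  qed
  show ?thesis
  proof (rule ex1I[of _ j])
    fix i assume "1 \<le> i \<and> exp (\<Sum>i\<in>{1..<i}. eps V i) \<le> x \<and> x < exp (?S i)"
    then show "i = j" using ok less[of i j] less[of j i] by (metis linorder_neqE_nat)
  qed (rule ok)
qed

lemma length_class:
  assumes "0 < V"
  shows "1 \<le> length_class V x"
    and "exp (\<Sum>i\<in>{1..<length_class V x}. eps V i) \<le> max 1 x"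
    and "max 1 x < exp (\<Sum>i\<in>{1..length_class V x}. eps V i)"
  using theI'[OF exists_unique_eps_interval[OF assms, of "max 1 x"]]
  unfolding length_class_def by auto

section \<open>The dynamic non-clairvoyant algorithm\<close>

lemma take_filter_upt:
  assumes "q < length (filter P [0..<i])"
  shows "take q (filter P [0..<i]) = filter P [0..<filter P [0..<i] ! q]"
  using assms
proof (induction i)
  case (Suc i)
  then show ?case
    by (cases "q < length (filter P [0..<i])") (auto simp: nth_append split: if_splits)
qed simp

context packing
begin

definition sizes_before :: "nat set \<Rightarrow> nat \<Rightarrow> real list" where
  "sizes_before G i = map w (filter (\<lambda>p. p \<in> G) [0..<i])"

text \<open>Departures are invisible to the static algorithm: the bin depends only on the sizes that
  the copy has received, so static bounds on bins apply unchanged.\<close>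

definition bin_of :: "'b static_alg \<Rightarrow> nat set \<Rightarrow> nat \<Rightarrow> 'b" where
  "bin_of A G i = A (sizes_before G i) (w i)"

lemma sizes_before_Suc: "i \<in> G \<Longrightarrow> sizes_before G (Suc i) = sizes_before G i @ [w i]"
  by (simp add: sizes_before_def)

lemma sizes_before_prefix:
  assumes "i \<le> j"
  shows "\<exists>ys. sizes_before G j = sizes_before G i @ ys"
  using upt_add_eq_append[of 0 i "j - i"] assms by (simp add: sizes_before_def)

lemma set_sizes_before: "set (sizes_before G i) = w ` {p \<in> G. p < i}"
  by (auto simp: sizes_before_def)

lemma sizes_before_in:
  assumes "G \<subseteq> {..<n}" "x \<in> set (sizes_before G i)"
  shows "0 < x" "x \<le> 1"
  using assms item(4,5) by (auto simp: set_sizes_before)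

lemma sum_list_sizes_before:
  assumes "G \<subseteq> {..<n}"
  shows "sum_list (sizes_before G n) = sum w G"
proof -
  have "sum_list (sizes_before G n) = sum w (set (filter (\<lambda>p. p \<in> G) [0..<n]))"
    unfolding sizes_before_def by (subst sum_list_distinct_conv_sum_set) auto
  also have "set (filter (\<lambda>p. p \<in> G) [0..<n]) = G" using assms by auto
  finally show ?thesis .
qed

text \<open>The algorithm searches positions of its own history, the analysis uses positions of the
  instance. The translation \<open>q \<mapsto> xs ! q\<close> is increasing, so the last item of a
  bin is the same in both views.\<close>

lemma nonclairvoyant_hist:
  assumes P: "P = {p \<in> G. p < i \<and> bin_of A G p = bin_of A G i}" "P \<noteq> {}"
    and "open": "machine_open (hist f G i) (f (Max P)) (s i)"
  shows "nonclairvoyant A (hist f G i) (Is ! i) = Some (f (Max P))"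
proof -
  define xs where "xs = filter (\<lambda>p. p \<in> G) [0..<i]"
  have ws: "map (\<lambda>(J, m). width J) (hist f G i) = map w xs" by (simp add: hist_def xs_def)
  have mem: "xs ! q \<in> G" "xs ! q < i" if "q < length xs" for q
    using nth_mem[OF that] by (auto simp: xs_def)
  define P0 where "P0 = {q. q < length (hist f G i) \<and> A (take q (map w xs)) (map w xs ! q) = A (map w xs) (w i)}"
  have len: "length (hist f G i) = length xs" by (simp add: hist_def xs_def)
  have pref: "A (take q (map w xs)) (map w xs ! q) = bin_of A G (xs ! q)" if "q < length xs" for q
    using that take_filter_upt[of q "\<lambda>p. p \<in> G" i]
    by (simp add: bin_of_def sizes_before_def xs_def take_map)
  have P0: "P0 = {q. q < length xs \<and> bin_of A G (xs ! q) = bin_of A G i}"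
    using pref by (auto simp: P0_def len bin_of_def sizes_before_def xs_def)
  have img: "P = (!) xs ` P0"
  proof
    show "P \<subseteq> (!) xs ` P0"
    proof
      fix p assume "p \<in> P"
      then have "p \<in> set xs" "bin_of A G p = bin_of A G i" by (auto simp: P(1) xs_def)
      then show "p \<in> (!) xs ` P0" unfolding P0 by (auto simp: in_set_conv_nth)
    qed
  qed (use mem in \<open>auto simp: P0 P(1)\<close>)
  then have ne: "P0 \<noteq> {}" using P(2) by blast
  have fin: "finite P0" by (simp add: P0)
  have sorted: "sorted xs" by (simp add: xs_def sorted_wrt_filter)
  have mx: "Max P0 \<in> P0" using fin ne by simp
  have "Max P = xs ! Max P0"
  proof (rule Max_eqI)
    fix p assume "p \<in> P"
    then obtain q where "q \<in> P0" "p = xs ! q" using img by blast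
    then show "p \<le> xs ! Max P0"
      using mx fin sorted by (auto simp: P0 intro!: sorted_nth_mono)
  qed (use fin mx img in auto)
  then have "snd (hist f G i ! Max P0) = f (Max P)"
    using mx by (simp add: P0 hist_def flip: xs_def)
  then show ?thesis
    using ne "open" unfolding nonclairvoyant_def Let_def ws P0_def[symmetric] by simp
qed

context
  fixes G :: "nat set" and f :: "nat \<Rightarrow> nat" and A :: "'b static_alg"
  assumes G: "G \<subseteq> {..<n}"
    and nc: "\<And>i. i \<in> G \<Longrightarrow>
      f i = (case nonclairvoyant A (hist f G i) (Is ! i) of Some m \<Rightarrow> m | None \<Rightarrow> i)"
begin

text \<open>Let \<open>Max P\<close> be the last item of the bin before \<open>q\<close>. Item
  \<open>p\<close> is still active when \<open>Max P\<close> arrives, so by induction they share a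
  machine; \<open>p\<close> keeps this machine open until \<open>q\<close> arrives, and
  \<open>q\<close> joins it.\<close>

lemma nonclairvoyant_same_machine:
  assumes "q \<in> G" "p \<in> G" "p < q" "bin_of A G p = bin_of A G q" "act p (s q)"
  shows "f p = f q"
  using assms
proof (induction q arbitrary: p rule: less_induct)
  case (less q)
  define P where "P = {p \<in> G. p < q \<and> bin_of A G p = bin_of A G q}"
  have "p \<in> P" using less.prems by (simp add: P_def)
  have fin: "finite P" by (simp add: P_def)
  have "Max P \<in> P" using fin \<open>p \<in> P\<close> by (auto intro: Max_in)
  then have mx: "Max P \<in> G" "Max P < q" "bin_of A G (Max P) = bin_of A G q" by (simp_all add: P_def)
  have same: "f p = f (Max P)"
  proof (cases "p = Max P")
    case False
    then have "p < Max P" using fin \<open>p \<in> P\<close> by (simp add: le_neq_implies_less)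
    moreover have "act p (s (Max P))"
      using less.prems(1,5) s_mono[of "Max P" q] s_mono[of p "Max P"] \<open>p < Max P\<close> mx G
      by (auto simp: active_def)
    ultimately show ?thesis using less.IH[OF mx(2,1), of p] mx(3) less.prems by simp
  qed simp
  have "machine_open (hist f G q) (f (Max P)) (s q)"
    unfolding machine_open_hist using less.prems same by auto
  then have "nonclairvoyant A (hist f G q) (Is ! q) = Some (f (Max P))"
    using \<open>p \<in> P\<close> by (intro nonclairvoyant_hist P_def) auto
  then show ?case using nc[OF less.prems(1)] same by simp
qed

text \<open>At any time at most one machine of each bin is open.\<close>

lemma nonclairvoyant_busy: "card (busy f G) \<le> card (busy (bin_of A G) G)"
proof -
  have same: "f i = f i'" if "i \<in> G" "i' \<in> G" "bin_of A G i = bin_of A G i'" "act i t" "act i' t" "i < i'" for i i' t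
    using nonclairvoyant_same_machine[of i' i] that s_mono[of i i'] G by (auto simp: active_def)
  define g where "g = (\<lambda>(\<beta>, t). (f (SOME i. i \<in> G \<and> bin_of A G i = \<beta> \<and> act i t), t))"
  have "busy f G \<subseteq> g ` busy (bin_of A G) G"
  proof
    fix z assume "z \<in> busy f G"
    then obtain i t where i: "i \<in> G" "act i t" "z = (f i, t)" by (auto simp: busy_def)
    define i' where "i' = (SOME i'. i' \<in> G \<and> bin_of A G i' = bin_of A G i \<and> act i' t)"
    have "i' \<in> G \<and> bin_of A G i' = bin_of A G i \<and> act i' t"
      unfolding i'_def by (rule someI[of _ i]) (use i in auto)
    then have "f i' = f i" using same[of i i' t] same[of i' i t] i by (metis linorder_neqE_nat)
    then have "z = g (bin_of A G i, t)" using i by (simp add: g_def i'_def)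
    moreover have "(bin_of A G i, t) \<in> busy (bin_of A G) G" using i by (auto simp: busy_def)
    ultimately show "z \<in> g ` busy (bin_of A G) G" by blast
  qed
  then show ?thesis using finite_busy[OF G] by (meson surj_card_le)
qed

end

text \<open>A bin contributes at most the maximum length after it has been closed; before that, it is
  the only bin of its class in use.\<close>

lemma class_fit_busy:
  assumes G: "G \<subseteq> {..<n}" and C: "finite C" "\<And>i. i \<in> G \<Longrightarrow> cl (w i) \<in> C"
    and b: "\<And>i. i \<in> G \<Longrightarrow> dur i \<le> b"
  shows "card (busy (bin_of (class_fit cl) G) G)
    \<le> b * (\<Sum>c\<in>C. class_closed cl (sizes_before G n) c) + card C * card {t. \<exists>i\<in>G. act i t}"
proof -
  let ?N = "class_closed cl (sizes_before G n)" and ?Y = "{t. \<exists>i\<in>G. act i t}"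
  define k where "k i = class_closed cl (sizes_before G (Suc i)) (cl (w i))" for i
  have bin: "bin_of (class_fit cl) G i = (cl (w i), k i)" if "i \<in> G" for i
    using that by (simp add: bin_of_def class_fit_eq k_def sizes_before_Suc)
  have mono: "class_closed cl (sizes_before G i) c \<le> class_closed cl (sizes_before G j) c" if ij: "i \<le> j" for i j c
  proof -
    obtain ys where ys: "sizes_before G j = sizes_before G i @ ys" using sizes_before_prefix[OF ij] by blast
    show ?thesis unfolding ys
      by (rule class_closed_mono) (use sizes_before_in[OF G, of _ j] in \<open>auto simp: ys less_imp_le\<close>)
  qed
  have k_less: "p < i" if "cl (w p) = cl (w i)" "k p < k i" for p i
  proof (rule ccontr)
    assume "\<not> p < i"
    then have "k i \<le> k p" using mono[of "Suc i" "Suc p"] that(1) by (simp add: k_def)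
    then show False using that by simp
  qed
  have k_le: "k i \<le> ?N (cl (w i))" if "i \<in> G" for i
    unfolding k_def using that G by (intro mono) auto
  define later where "later c m i \<longleftrightarrow> i \<in> G \<and> cl (w i) = c \<and> m < k i" for c m i
  \<comment> \<open>The time at which bin \<open>m\<close> of class \<open>c\<close> is closed,
    namely the first arrival of an item that goes into a later bin of the class. All items of the
    bin have started by then, so it is in use for fewer than \<open>b\<close> further steps or
    exactly up to \<open>\<tau> c m + b\<close>.\<close>
  define \<tau> where "\<tau> c m = (LEAST t. \<exists>i. later c m i \<and> s i = t)" for c m
  let ?B = "busy (bin_of (class_fit cl) G) G"
  let ?old = "{((c, m), t). ((c, m), t) \<in> ?B \<and> (\<exists>i. later c m i \<and> s i \<le> t)}"
  have finB: "finite ?B" using finite_busy[OF G] .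
  have "?old \<subseteq> (\<Union>cm\<in>Sigma C (\<lambda>c. {..<?N c}). (\<lambda>t. (cm, t)) ` {\<tau> (fst cm) (snd cm)..<\<tau> (fst cm) (snd cm) + b})"
  proof
    fix z assume "z \<in> ?old"
    then obtain c m t i where z: "z = ((c, m), t)" "((c, m), t) \<in> ?B" and i: "later c m i" "s i \<le> t" by blast
    from z obtain p where p: "p \<in> G" "cl (w p) = c" "k p = m" "act p t"
      using bin by (auto simp: busy_def)
    have "\<exists>i. later c m i \<and> s i = \<tau> c m" unfolding \<tau>_def by (rule LeastI[of _ "s i"]) (use i in blast)
    then obtain i0 where i0: "later c m i0" "s i0 = \<tau> c m" by blast
    have "\<tau> c m \<le> s i" unfolding \<tau>_def by (rule Least_le) (use i in blast)
    then have "\<tau> c m \<le> t" using i by simp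
    moreover have "p < i0" using i0 p k_less[of p i0] by (simp add: later_def)
    then have "s p \<le> \<tau> c m" using s_mono[of p i0] i0 G by (auto simp: later_def)
    then have "t < \<tau> c m + b" using p(4) b[OF p(1)] by (simp add: active_def le_diff_conv)
    moreover have "c \<in> C" "m < ?N c" using i k_le[of i] C by (auto simp: later_def)
    ultimately have "(c, m) \<in> Sigma C (\<lambda>c. {..<?N c})" "t \<in> {\<tau> c m..<\<tau> c m + b}" by auto
    then show "z \<in> (\<Union>cm\<in>Sigma C (\<lambda>c. {..<?N c}). (\<lambda>t. (cm, t)) ` {\<tau> (fst cm) (snd cm)..<\<tau> (fst cm) (snd cm) + b})"
      unfolding z(1) by (intro UN_I[of "(c, m)"] image_eqI[of _ _ t]) simp_all
  qed
  then have "card ?old \<le> card (\<Union>cm\<in>Sigma C (\<lambda>c. {..<?N c}). (\<lambda>t. (cm, t)) ` {\<tau> (fst cm) (snd cm)..<\<tau> (fst cm) (snd cm) + b})"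
    using C by (intro card_mono) auto
  also have "\<dots> \<le> (\<Sum>cm\<in>Sigma C (\<lambda>c. {..<?N c}). card ((\<lambda>t. (cm, t)) ` {\<tau> (fst cm) (snd cm)..<\<tau> (fst cm) (snd cm) + b}))"
    using C by (intro card_UN_le) auto
  also have "\<dots> \<le> (\<Sum>cm\<in>Sigma C (\<lambda>c. {..<?N c}). b)"
    by (intro sum_mono order_trans[OF card_image_le]) auto
  also have "\<dots> = b * (\<Sum>c\<in>C. ?N c)" using C by simp
  finally have old: "card ?old \<le> b * (\<Sum>c\<in>C. ?N c)" .
  have "finite ?Y" using act_in_range G by (intro finite_subset[of ?Y "{1..T}"]) blast+
  then have "card (?B - ?old) \<le> card (C \<times> ?Y)"
  proof (intro card_inj_on_le[of "\<lambda>((c, m), t). (c, t)"])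
    \<comment> \<open>Of two bins of one class in use at the same time, the one with the smaller
      index is already closed. Outside \<open>?old\<close> the class and the time therefore
      determine the bin.\<close>
    have "m = m'" if m: "((c, m), t) \<in> ?B - ?old" "((c, m'), t) \<in> ?B - ?old" for c m m' t
    proof -
      have *: "\<not> x < y" if xy: "((c, x), t) \<in> ?B - ?old" "((c, y), t) \<in> ?B" for x y
      proof
        assume "x < y"
        from xy(2) obtain i where "i \<in> G" "cl (w i) = c" "k i = y" "act i t"
          using bin by (auto simp: busy_def)
        then have "later c x i \<and> s i \<le> t" using \<open>x < y\<close> by (simp add: later_def active_def)
        then show False using xy(1) by blast
      qed
      show ?thesis using *[of m m'] *[of m' m] m by (meson DiffD1 linorder_neqE_nat)
    qed
    then show "inj_on (\<lambda>((c, m), t). (c, t)) (?B - ?old)" unfolding inj_on_def by fast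
    show "(\<lambda>((c, m), t). (c, t)) ` (?B - ?old) \<subseteq> C \<times> ?Y"
      using bin C(2) by (fastforce simp: busy_def)
  qed (use C in simp)
  then have "card (?B - ?old) \<le> card C * card ?Y" by (simp add: card_cartesian_product)
  moreover have "card ?B = card (?B - ?old) + card ?old"
  proof -
    have "?old \<subseteq> ?B" by auto
    then show ?thesis using finB card_mono[of ?B ?old] by (simp add: card_Diff_subset finite_subset)
  qed
  ultimately show ?thesis using old by simp
qed

text \<open>Double counting: an item that is active when \<open>i \<in> G\<close> arrives has started by every time \<open>t\<close>
  at which \<open>i\<close> is active, and ends after \<open>t - b\<close>; each item is counted for at most \<open>2 * b\<close> times \<open>t\<close>.\<close>

lemma busy_times_le_demand:
  assumes K: "K \<subseteq> {..<n}" and G: "G \<subseteq> K" and q: "0 \<le> q"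
    and ab: "\<And>i. i \<in> K \<Longrightarrow> a \<le> dur i" "\<And>i. i \<in> K \<Longrightarrow> dur i \<le> b"
    and load: "\<And>i. i \<in> G \<Longrightarrow> q \<le> (\<Sum>p | p \<in> K \<and> p \<le> i \<and> act p (s i). w p)"
  shows "real (card {t. \<exists>i\<in>G. act i t}) * (q * real a) \<le> 2 * real b * demand K"
proof -
  let ?Y = "{t. \<exists>i\<in>G. act i t}"
  have finK: "finite K" using K finite_subset by blast
  have finY: "finite ?Y" using act_in_range G K by (intro finite_subset[of ?Y "{1..T}"]) blast+
  have wpos: "0 \<le> w p" if "p \<in> K" for p using item(4)[of p] K that by auto
  let ?near = "\<lambda>p t. s p \<le> t \<and> t < e p + b"
  have "q * real a \<le> (\<Sum>p | p \<in> K \<and> ?near p t. real (dur p) * w p)" if t: "t \<in> ?Y" for t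
  proof -
    obtain i where i: "i \<in> G" "act i t" using t by blast
    have "q * real a \<le> (\<Sum>p | p \<in> K \<and> p \<le> i \<and> act p (s i). w p) * real a"
      using load[OF i(1)] by (intro mult_right_mono) auto
    also have "\<dots> \<le> (\<Sum>p | p \<in> K \<and> p \<le> i \<and> act p (s i). real (dur p) * w p)"
      unfolding sum_distrib_right mult.commute[of "w _"] using ab wpos
      by (intro sum_mono mult_right_mono) auto
    also have "\<dots> \<le> (\<Sum>p | p \<in> K \<and> ?near p t. real (dur p) * w p)"
    proof (rule sum_mono2)
      show "{p \<in> K. p \<le> i \<and> act p (s i)} \<subseteq> {p \<in> K. ?near p t}"
        using i ab(2)[of i] G by (auto simp: active_def)
    qed (use finK wpos in auto)
    finally show ?thesis .
  qed
  then have "real (card ?Y) * (q * real a) \<le> (\<Sum>t\<in>?Y. \<Sum>p | p \<in> K \<and> ?near p t. real (dur p) * w p)"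
    using sum_mono[of ?Y "\<lambda>_. q * real a"] by simp
  also have "\<dots> = (\<Sum>p\<in>K. \<Sum>t | t \<in> ?Y \<and> ?near p t. real (dur p) * w p)"
    by (rule sum.swap_restrict[OF finY finK])
  also have "\<dots> \<le> (\<Sum>p\<in>K. 2 * real b * (real (dur p) * w p))"
  proof (rule sum_mono)
    fix p assume p: "p \<in> K"
    have "card {t \<in> ?Y. ?near p t} \<le> card {s p..<e p + b}" by (intro card_mono) auto
    also have "\<dots> \<le> 2 * b" using ab(2)[OF p] by simp
    finally have "real (card {t \<in> ?Y. ?near p t}) \<le> 2 * real b" by simp
    then have "real (card {t \<in> ?Y. ?near p t}) * (real (dur p) * w p) \<le> 2 * real b * (real (dur p) * w p)"
      using wpos[OF p] by (intro mult_right_mono) auto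
    then show "(\<Sum>t | t \<in> ?Y \<and> ?near p t. real (dur p) * w p) \<le> 2 * real b * (real (dur p) * w p)"
      by simp
  qed
  also have "\<dots> = 2 * real b * demand K" by (simp add: demand_def sum_distrib_left)
  finally show ?thesis .
qed

end

section \<open>Closed bins against the offline optimum\<close>

lemma distinct_concat_map:
  assumes "distinct xs" "\<And>x. x \<in> set xs \<Longrightarrow> distinct (g x)"
    "\<And>x y. x \<in> set xs \<Longrightarrow> y \<in> set xs \<Longrightarrow> x \<noteq> y \<Longrightarrow> set (g x) \<inter> set (g y) = {}"
  shows "distinct (concat (map g xs))"
  using assms
proof (induction xs)
  case (Cons x xs)
  then have "distinct (concat (map g xs))" by simp
  moreover have "set (g x) \<inter> (\<Union>y\<in>set xs. set (g y)) = {}"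
    using Cons.prems(1) Cons.prems(3)[of x] by fastforce
  ultimately show ?case using Cons.prems(2) by simp
qed simp

lemma class_closed_concat:
  assumes "\<forall>xs\<in>set xss. \<forall>x\<in>set xs. 0 \<le> x"
  shows "(\<Sum>xs\<leftarrow>xss. class_closed cl xs c) \<le> class_closed cl (concat xss) c"
  using assms
proof (induction xss)
  case (Cons xs xss)
  then have "(\<Sum>ys\<leftarrow>xs # xss. class_closed cl ys c) \<le> class_closed cl xs c + class_closed cl (concat xss) c"
    by simp
  also have "\<dots> \<le> class_closed cl (concat (xs # xss)) c"
    using class_closed_append[of xs "concat xss" cl c] Cons.prems by auto
  finally show ?case .
qed simp

context packing
begin

text \<open>Each item of \<open>G j\<close> appears in \<open>N * a j\<close> copies. The copies with number \<open>y\<close> are packed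
  into a bin for the machine that processes the item in an optimal schedule, the time
  \<open>s i + y div N\<close>, at which the item is active, and the residue \<open>y mod N\<close>.\<close>

lemma harmonic_closed_le_opt:
  fixes J :: nat
  assumes k: "1 \<le> k" and G: "\<And>j. G j \<subseteq> {..<n}"
    and disj: "\<And>i j. i \<noteq> j \<Longrightarrow> G i \<inter> G j = {}"
    and a: "\<And>j i. i \<in> G j \<Longrightarrow> a j \<le> dur i"
  shows "real (\<Sum>j=1..J. a j * (\<Sum>c\<in>{1..k}. class_closed (harmonic_class k) (sizes_before (G j) n) c))
    \<le> asymptotic_ratio (harmonic k) * real (opt_cost Is)"
proof -
  let ?cl = "harmonic_class k"
  let ?sb = "\<lambda>j. sizes_before (G j) n"
  obtain f where f: "feasible Is f" "cost Is f = opt_cost Is" by (rule optimal_schedule)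
  define js where "js = [1..<Suc J]"
  define xs where "xs j = filter (\<lambda>p. p \<in> G j) [0..<n]" for j
  \<comment> \<open>The order matters: for each \<open>j\<close> the complete arrival sequence of
    \<open>G j\<close> is repeated in consecutive blocks, so superadditivity counts its closed bins
    \<open>N * a j\<close> times.\<close>
  define zs where "zs N = concat (map (\<lambda>j. concat (map (\<lambda>y. map (\<lambda>i. (i, y)) (xs j)) [0..<N * a j])) js)" for N
  define ws where "ws N = map (\<lambda>z. w (fst z)) (zs N)" for N
  have set_js: "set js = {1..J}" by (auto simp: js_def)
  have set_xs: "set (xs j) = G j" for j using G by (auto simp: xs_def)
  have in_zs: "(i, y) \<in> set (zs N) \<longleftrightarrow> (\<exists>j\<in>set js. i \<in> G j \<and> y < N * a j)" for i y N
    by (fastforce simp: zs_def set_xs image_iff)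
  have G_n: "i < n" if "i \<in> G j" for i j using G that by blast
  have dist: "distinct (zs N)" for N
    unfolding zs_def
  proof (intro distinct_concat_map)
    show "distinct js" by (simp add: js_def)
    show "distinct (map (\<lambda>i. (i, y)) (xs j))" for j and y :: nat
      by (simp add: distinct_map inj_on_def xs_def)
  qed (use disj in \<open>auto simp: set_xs\<close>)
  have ws_eq: "ws N = concat (concat (map (\<lambda>j. replicate (N * a j) (?sb j)) js))" for N
  proof -
    have "map (\<lambda>z. w (fst z)) (concat (map (\<lambda>y. map (\<lambda>i. (i, y)) (xs j)) [0..<N * a j]))
        = concat (replicate (N * a j) (?sb j))" for j
      by (simp add: map_concat o_def xs_def sizes_before_def map_replicate_const)
    moreover have "concat (concat yss) = concat (map concat yss)" for yss :: "real list list list"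
      by (induction yss) auto
    ultimately show ?thesis by (simp add: ws_def zs_def map_concat o_def)
  qed
  have ws: "\<forall>x\<in>set (ws N). 0 < x \<and> x \<le> 1" for N
    using item(4,5) G_n by (auto simp: ws_def in_zs)
  have z: "0 < real (opt_cost Is)"
  proof -
    have "0 < demand {..<n}"
      unfolding demand_def using item(2,4) Is_nonempty by (intro sum_pos) auto
    then show ?thesis using demand_le_opt by linarith
  qed
  show ?thesis
  proof (rule asymptotic_ratio_harmonic_ge[OF k z, of ws])
    fix N
    show "\<forall>x\<in>set (ws N). 0 < x \<and> x \<le> 1" by (rule ws)
    have "N * (\<Sum>j=1..J. a j * (\<Sum>c\<in>{1..k}. class_closed ?cl (?sb j) c))
        = (\<Sum>j\<in>set js. \<Sum>c\<in>{1..k}. N * a j * class_closed ?cl (?sb j) c)"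
      unfolding set_js by (simp add: sum_distrib_left mult.assoc)
    also have "\<dots> = (\<Sum>c\<in>{1..k}. \<Sum>j\<in>set js. N * a j * class_closed ?cl (?sb j) c)"
      by (rule sum.swap)
    also have "\<dots> = (\<Sum>c\<in>{1..k}. \<Sum>xs\<leftarrow>concat (map (\<lambda>j. replicate (N * a j) (?sb j)) js). class_closed ?cl xs c)"
    proof (intro sum.cong refl)
      fix c
      have "(\<Sum>xs\<leftarrow>concat (map (\<lambda>j. replicate (N * a j) (?sb j)) js). class_closed ?cl xs c)
          = (\<Sum>j\<leftarrow>js. N * a j * class_closed ?cl (?sb j) c)"
        by (induction js) (auto simp: sum_list_replicate)
      also have "\<dots> = (\<Sum>j\<in>set js. N * a j * class_closed ?cl (?sb j) c)"
        by (intro sum_list_distinct_conv_sum_set) (simp add: js_def)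
      finally show "(\<Sum>j\<in>set js. N * a j * class_closed ?cl (?sb j) c)
          = (\<Sum>xs\<leftarrow>concat (map (\<lambda>j. replicate (N * a j) (?sb j)) js). class_closed ?cl xs c)" ..
    qed
    also have "\<dots> \<le> (\<Sum>c\<in>{1..k}. class_closed ?cl (ws N) c)"
      unfolding ws_eq using sizes_before_in[OF G]
      by (intro sum_mono class_closed_concat) (auto simp: less_imp_le)
    also have "\<dots> \<le> num_bins (harmonic k) (ws N)"
      unfolding harmonic_eq_class_fit using ws by (intro sum_class_closed_le_num_bins) auto
    finally show "real N * real (\<Sum>j=1..J. a j * (\<Sum>c\<in>{1..k}. class_closed ?cl (?sb j) c))
        \<le> real (num_bins (harmonic k) (ws N))"
      unfolding of_nat_mult[symmetric] of_nat_le_iff .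
    define \<beta> where "\<beta> = (\<lambda>(i, y). ((f i, s i + y div N), y mod N))"
    have \<beta>: "N \<noteq> 0 \<and> i < n \<and> act i (s i + y div N)" if iy: "(i, y) \<in> set (zs N)" for i y
    proof -
      obtain j where j: "i \<in> G j" "y < N * a j" using iy in_zs by blast
      then have "y div N < a j" using less_mult_imp_div_less[of y "a j" N] by (simp add: mult.commute)
      moreover have "N \<noteq> 0" using j by (intro notI) simp
      ultimately show ?thesis using a[OF j(1)] G_n[OF j(1)] by (simp add: active_def)
    qed
    have "opt_bins (ws N) \<le> card (busy f {..<n} \<times> {..<N})"
      unfolding ws_def
    proof (rule opt_bins_le[OF _ dist, where \<beta> = \<beta>])
      show "finite (busy f {..<n} \<times> {..<N})" by (intro finite_cartesian_product finite_busy) auto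
      show "\<beta> ` set (zs N) \<subseteq> busy f {..<n} \<times> {..<N}"
      proof
        fix b assume "b \<in> \<beta> ` set (zs N)"
        then obtain i y where "(i, y) \<in> set (zs N)" "b = \<beta> (i, y)" by auto
        then show "b \<in> busy f {..<n} \<times> {..<N}" using \<beta>[of i y] by (auto simp: \<beta>_def busy_def)
      qed
      fix b assume "b \<in> busy f {..<n} \<times> {..<N}"
      then obtain m t r where b: "b = ((m, t), r)" by (metis surj_pair)
      let ?Z = "{z. z \<in> set (zs N) \<and> \<beta> z = b}"
      \<comment> \<open>For a given item, \<open>t\<close> and \<open>r\<close> fix quotient and
        remainder of the copy number. A bin thus holds each item at most once, and its content is a
        subset of what machine \<open>m\<close> processes at time \<open>t\<close>.\<close>
      have inj: "inj_on fst ?Z"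
      proof (rule inj_onI)
        fix z z' assume zz: "z \<in> ?Z" "z' \<in> ?Z" "fst z = fst z'"
        then have "snd z div N = snd z' div N" "snd z mod N = snd z' mod N"
          by (auto simp: \<beta>_def b split: prod.splits)
        then have "snd z = snd z'" by (metis mult_div_mod_eq)
        then show "z = z'" using zz(3) by (simp add: prod_eq_iff)
      qed
      have "(\<Sum>z\<in>?Z. w (fst z)) = sum w (fst ` ?Z)" using sum.reindex[OF inj, of w] by (simp add: o_def)
      also have "\<dots> \<le> (\<Sum>i | i < n \<and> f i = m \<and> act i t. w i)"
      proof (rule sum_mono2)
        show "fst ` ?Z \<subseteq> {i. i < n \<and> f i = m \<and> act i t}"
          using \<beta> by (fastforce simp: \<beta>_def b)
      qed (use item(4) in \<open>auto simp: less_imp_le\<close>)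
      also have "\<dots> \<le> 1" using f(1) by (simp add: feasible_def)
      finally show "(\<Sum>z\<in>?Z. w (fst z)) \<le> 1" .
    qed
    then show "real (opt_bins (ws N)) \<le> real N * real (opt_cost Is)"
      using f(2) by (simp add: cost_eq_card_busy card_cartesian_product mult.commute flip: of_nat_mult)
  qed
qed

section \<open>Volume bounds and the uniform case\<close>

lemma sum_demand_disjoint:
  fixes J :: nat
  assumes "\<And>j. G j \<subseteq> {..<n}" "\<And>i j. i \<noteq> j \<Longrightarrow> G i \<inter> G j = {}"
  shows "(\<Sum>j=1..J. demand (G j)) \<le> demand {..<n}"
proof -
  have "(\<Sum>j=1..J. demand (G j)) = demand (\<Union>j\<in>{1..J}. G j)"
    unfolding demand_def using assms finite_subset[OF assms(1)]
    by (intro sum.UNION_disjoint[symmetric]) auto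
  also have "\<dots> \<le> demand {..<n}" using assms(1) by (intro demand_mono) auto
  finally show ?thesis .
qed

lemma mult_sum_sizes_le_demand:
  assumes "G \<subseteq> {..<n}" "\<And>i. i \<in> G \<Longrightarrow> a \<le> dur i"
  shows "real a * sum_list (sizes_before G n) \<le> demand G"
  unfolding sum_list_sizes_before[OF assms(1)] demand_def sum_distrib_left
  using assms item(4) by (intro sum_mono mult_right_mono) (auto simp: less_imp_le)

text \<open>Closed bins are full, so weighted by the minimum duration they cost at most the demand,
  which is at most the optimum. The forms \<open>{0}\<close> and \<open>1 *\<close> match the
  statement for Harmonic, with one class and ratio 1.\<close>

lemma next_fit_closed_le_opt:
  fixes J :: nat
  assumes g: "1 \<le> g" and width: "\<forall>I\<in>set Is. width I = 1 / real g"
    and G: "\<And>j. G j \<subseteq> {..<n}"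
    and disj: "\<And>i j. i \<noteq> j \<Longrightarrow> G i \<inter> G j = {}"
    and a: "\<And>j i. i \<in> G j \<Longrightarrow> a j \<le> dur i"
  shows "real (\<Sum>j=1..J. a j * (\<Sum>c\<in>{0}. class_closed (\<lambda>_. 0) (sizes_before (G j) n) c))
    \<le> 1 * real (opt_cost Is)"
proof -
  have "real (\<Sum>j=1..J. a j * (\<Sum>c\<in>{0}. class_closed (\<lambda>_. 0) (sizes_before (G j) n) c))
      = (\<Sum>j=1..J. real (a j) * real (closed_bins (sizes_before (G j) n)))"
    by (simp add: class_closed_def)
  also have "\<dots> \<le> (\<Sum>j=1..J. demand (G j))"
  proof (intro sum_mono)
    fix j
    have "\<forall>x\<in>set (sizes_before (G j) n). x = 1 / real g"
      using width G by (auto simp: set_sizes_before)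
    then have "real (a j) * real (closed_bins (sizes_before (G j) n)) \<le> real (a j) * sum_list (sizes_before (G j) n)"
      using g by (intro mult_left_mono closed_bins_uniform_le_sum) auto
    also have "\<dots> \<le> demand (G j)" using G a by (intro mult_sum_sizes_le_demand) auto
    finally show "real (a j) * real (closed_bins (sizes_before (G j) n)) \<le> demand (G j)" .
  qed
  also have "\<dots> \<le> demand {..<n}" using G disj by (rule sum_demand_disjoint)
  also have "\<dots> \<le> 1 * real (opt_cost Is)" using demand_le_opt by simp
  finally show ?thesis .
qed

section \<open>The Combined Algorithm\<close>

lemma length_placements: "length (placements A V Is l i) = i"
  by (induction i) (auto simp: Let_def)

lemma placements_prefix:
  assumes "p < i" "i \<le> j"
  shows "placements A V Is l j ! p = placements A V Is l i ! p"
  using assms(2)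
proof (induction j rule: dec_induct)
  case (step j)
  then show ?case using assms(1) by (simp add: Let_def nth_append length_placements)
qed simp

text \<open>Turns the stepwise construction into an equation for the finished assignment, which is
  all that the analysis of each copy assumes. Later steps only append, and the history before
  \<open>i\<close> reads only entries below \<open>i\<close>.\<close>

lemma combined_eq:
  fixes A :: "'b static_alg" and V :: real and l :: "nat \<Rightarrow> real"
  assumes "i < n"
  defines "f \<equiv> combined A V Is l" and "G \<equiv> {p. p < n \<and> handler V Is l p = handler V Is l i}"
  shows "f i = (case (if handler V Is l i = 0 then first_fit (hist f G i) (Is ! i)
      else nonclairvoyant A (hist f G i) (Is ! i)) of Some m \<Rightarrow> m | None \<Rightarrow> i)"
proof -
  have "filter (\<lambda>p. handler V Is l p = handler V Is l i) [0..<i] = filter (\<lambda>p. p \<in> G) [0..<i]"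
    using assms(1) by (intro filter_cong) (auto simp: G_def)
  moreover have "map (\<lambda>p. (Is ! p, placements A V Is l i ! p)) (filter (\<lambda>p. p \<in> G) [0..<i]) = hist f G i"
    unfolding hist_def f_def combined_def using assms(1)
    by (intro map_cong) (auto simp: placements_prefix[of _ i n])
  moreover have "f i = placements A V Is l (Suc i) ! i"
    using assms(1) by (simp add: f_def combined_def placements_prefix[of i "Suc i" n] del: placements.simps)
  ultimately show ?thesis
    by (simp only: placements.simps Let_def nth_append length_placements less_irrefl if_False
        diff_self_eq_0 nth_Cons_0)
qed

end

section \<open>Both cases at once: any \<open>class_fit\<close>, with the ratio \<open>P\<close> as
  a parameter\<close>

context packing
begin

context
  fixes A :: "(nat \<times> nat) static_alg" and cl :: "real \<Rightarrow> nat" and C :: "nat set" and k :: nat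
    and V :: real and l :: "nat \<Rightarrow> real" and P :: real
  assumes A: "A = class_fit cl"
    and C: "finite C" "card C \<le> k" "\<And>x. 0 < x \<Longrightarrow> x \<le> 1 \<Longrightarrow> cl x \<in> C"
    and V: "0 < V"
    and closed_le_opt: "\<And>G a J. (\<And>j. G j \<subseteq> {..<n}) \<Longrightarrow> (\<And>i j. i \<noteq> j \<Longrightarrow> G i \<inter> G j = {}) \<Longrightarrow>
      (\<And>j i. i \<in> G j \<Longrightarrow> a j \<le> dur i) \<Longrightarrow>
      real (\<Sum>j=1..J::nat. a j * (\<Sum>c\<in>C. class_closed cl (sizes_before (G j) n) c))
        \<le> P * real (opt_cost Is)"
begin

definition cls :: "nat \<Rightarrow> nat" where
  "cls i = length_class V (l i)"

definition class_items :: "nat \<Rightarrow> nat set" where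
  "class_items j = {i. i < n \<and> cls i = j}"

definition handled :: "nat \<Rightarrow> nat set" where
  "handled j = {i. i < n \<and> handler V Is l i = j}"

definition last_class :: nat where
  "last_class = Max (cls ` {..<n})"

abbreviation "schedule \<equiv> combined A V Is l"

lemma cls_le_last: "i < n \<Longrightarrow> cls i \<in> {1..last_class}"
  using length_class(1)[OF V] by (auto simp: last_class_def cls_def)

lemma handled_subset: "handled j \<subseteq> {..<n}" "class_items j \<subseteq> {..<n}"
  by (auto simp: handled_def class_items_def)

lemma handled_class: "1 \<le> j \<Longrightarrow> handled j \<subseteq> class_items j"
  by (auto simp: handled_def class_items_def handler_def Let_def cls_def split: if_splits)

lemma handler_range: "i < n \<Longrightarrow> handler V Is l i \<le> last_class"
  using cls_le_last[of i] by (auto simp: handler_def Let_def cls_def)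

lemma class_load_eq:
  assumes "i < n"
  shows "class_load V Is l i = (\<Sum>p | p \<in> class_items (cls i) \<and> p \<le> i \<and> act p (s i). w p)"
  unfolding class_load_def class_items_def cls_def using assms by (intro sum.cong) auto

lemma threshold_nonneg: "0 \<le> threshold V j"
  using V by (simp add: threshold_def)

text \<open>The last active item of a class that was handled by First-Fit arrived while all the others
  were active.\<close>

lemma first_fit_load:
  "(\<Sum>i | i \<in> handled 0 \<and> act i t. w i) \<le> (\<Sum>j=1..last_class. threshold V j)"
proof -
  let ?F = "{i. i \<in> handled 0 \<and> act i t}"
  have fin: "finite ?F" using finite_subset[OF handled_subset(1)] by auto
  have "sum w ?F = (\<Sum>j=1..last_class. \<Sum>i | i \<in> ?F \<and> cls i = j. w i)"
    using fin cls_le_last handled_subset(1)[of 0] by (intro sum.group[symmetric]) auto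
  also have "\<dots> \<le> (\<Sum>j=1..last_class. threshold V j)"
  proof (intro sum_mono)
    fix j
    let ?Fj = "{i. i \<in> ?F \<and> cls i = j}"
    show "sum w ?Fj \<le> threshold V j"
    proof (cases "?Fj = {}")
      case True
      show ?thesis unfolding True using threshold_nonneg by simp
    next
      case False
      have finj: "finite ?Fj" by (rule finite_subset[OF _ fin]) auto
      define i where "i = Max ?Fj"
      have "i \<in> ?Fj" unfolding i_def using finj False by (rule Max_in)
      then have i: "i < n" "handler V Is l i = 0" "act i t" "cls i = j" by (auto simp: handled_def)
      have "sum w ?Fj \<le> (\<Sum>p | p \<in> class_items (cls i) \<and> p \<le> i \<and> act p (s i). w p)"
      proof (rule sum_mono2)
        show "?Fj \<subseteq> {p. p \<in> class_items (cls i) \<and> p \<le> i \<and> act p (s i)}"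
        proof
          fix p assume p: "p \<in> ?Fj"
          then have "p \<le> i" unfolding i_def using finj by (intro Max_ge)
          moreover have "p < n" "act p t" "cls p = j" using p by (auto simp: handled_def)
          ultimately show "p \<in> {p. p \<in> class_items (cls i) \<and> p \<le> i \<and> act p (s i)}"
            using i s_mono[of p i] by (auto simp: class_items_def active_def)
        qed
      qed (use item(4) in \<open>auto simp: class_items_def less_imp_le\<close>)
      also have "\<dots> \<le> threshold V j"
        using i length_class(1)[OF V, of "l i"] class_load_eq[OF i(1)]
        by (auto simp: handler_def Let_def cls_def split: if_splits)
      finally show ?thesis .
    qed
  qed
  finally show ?thesis .
qed

lemma first_fit_cost:
  "real (card (busy schedule (handled 0))) \<le> real T * (4 * (\<Sum>j=1..last_class. threshold V j) + 1)"
proof (rule first_fit_busy)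
  fix i assume "i \<in> handled 0"
  then have i: "i < n" "handler V Is l i = 0" by (auto simp: handled_def)
  show "schedule i = (case first_fit (hist schedule (handled 0) i) (Is ! i) of Some m \<Rightarrow> m | None \<Rightarrow> i)"
    using combined_eq[OF i(1), of A V l] i(2) by (simp add: handled_def)
qed (rule handled_subset first_fit_load)+

text \<open>Range of the true durations in a class, although classes are formed by given lengths.
  The value 1 for an empty class keeps the minimum positive and ratio bounds valid.\<close>

definition min_dur :: "nat \<Rightarrow> nat" where
  "min_dur j = (if class_items j = {} then 1 else Min ((\<lambda>i. dur i) ` class_items j))"

definition max_dur :: "nat \<Rightarrow> nat" where
  "max_dur j = (if class_items j = {} then 1 else Max ((\<lambda>i. dur i) ` class_items j))"

abbreviation "nclosed j \<equiv> \<Sum>c\<in>C. class_closed cl (sizes_before (handled j) n) c"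

abbreviation "busy_times j \<equiv> {t. \<exists>i\<in>handled j. act i t}"

lemma finite_class_items: "finite (class_items j)"
  by (simp add: class_items_def)

lemma dur_bounds: "i \<in> class_items j \<Longrightarrow> min_dur j \<le> dur i \<and> dur i \<le> max_dur j"
  using finite_class_items by (auto simp: min_dur_def max_dur_def)

lemma max_dur_le:
  assumes "1 \<le> \<rho>" "\<And>i i'. i \<in> class_items j \<Longrightarrow> i' \<in> class_items j \<Longrightarrow> real (dur i) \<le> \<rho> * real (dur i')"
  shows "real (max_dur j) \<le> \<rho> * real (min_dur j)"
proof (cases "class_items j = {}")
  case False
  let ?D = "(\<lambda>i. dur i) ` class_items j"
  have "Max ?D \<in> ?D" "Min ?D \<in> ?D" using False finite_class_items by auto
  then show ?thesis using assms(2) False by (auto simp: min_dur_def max_dur_def)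
qed (use assms(1) in \<open>simp add: min_dur_def max_dur_def\<close>)

lemma min_dur_pos: "0 < min_dur j"
proof (cases "class_items j = {}")
  case False
  let ?D = "(\<lambda>i. dur i) ` class_items j"
  have "Min ?D \<in> ?D" using False finite_class_items by auto
  then show ?thesis using False item(2) by (auto simp: min_dur_def class_items_def)
qed (simp add: min_dur_def)

lemma nonclairvoyant_cost:
  assumes "1 \<le> j"
  shows "real (card (busy schedule (handled j)))
    \<le> real (max_dur j) * real (nclosed j) + real k * real (card (busy_times j))"
proof -
  have "card (busy schedule (handled j)) \<le> card (busy (bin_of A (handled j)) (handled j))"
  proof (rule nonclairvoyant_busy)
    fix i assume "i \<in> handled j"
    then have i: "i < n" "handler V Is l i = j" by (auto simp: handled_def)
    show "schedule i = (case nonclairvoyant A (hist schedule (handled j) i) (Is ! i) of Some m \<Rightarrow> m | None \<Rightarrow> i)"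
      using combined_eq[OF i(1), of A V l] i(2) assms by (simp add: handled_def)
  qed (rule handled_subset)
  also have "\<dots> \<le> max_dur j * nclosed j + card C * card (busy_times j)"
    unfolding A using C item(4,5) handled_subset dur_bounds handled_class[OF assms]
    by (intro class_fit_busy) (auto simp: subset_iff)
  also have "\<dots> \<le> max_dur j * nclosed j + k * card (busy_times j)" using C by simp
  finally show ?thesis by (simp only: of_nat_mult[symmetric] of_nat_add[symmetric] of_nat_le_iff)
qed

lemma card_busy_times_le_T: "card (busy_times j) \<le> T"
proof -
  have "busy_times j \<subseteq> {1..T}" using act_in_range handled_subset by blast
  then show ?thesis using card_mono[of "{1..T}" "busy_times j"] by simp
qed

lemma card_busy_times_le:
  assumes j: "1 \<le> j" and B: "real (max_dur j) \<le> B * real (min_dur j)" and q: "0 < threshold V j"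
  shows "real (card (busy_times j)) \<le> 2 * B * demand (class_items j) / threshold V j"
proof -
  have "real (card (busy_times j)) * (threshold V j * real (min_dur j))
      \<le> 2 * real (max_dur j) * demand (class_items j)"
  proof (rule busy_times_le_demand)
    fix i assume "i \<in> handled j"
    then have i: "i < n" "handler V Is l i = j" by (auto simp: handled_def)
    moreover from i have "cls i = j" "\<not> class_load V Is l i \<le> threshold V j"
      using j by (auto simp: handler_def Let_def cls_def split: if_splits)
    ultimately show "threshold V j \<le> (\<Sum>p | p \<in> class_items j \<and> p \<le> i \<and> act p (s i). w p)"
      using class_load_eq[OF i(1)] by simp
  qed (use handled_subset handled_class[OF j] dur_bounds threshold_nonneg in auto)
  also have "\<dots> \<le> 2 * (B * real (min_dur j)) * demand (class_items j)"
    using B demand_nonneg[OF handled_subset(2)] by (intro mult_right_mono mult_left_mono) auto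
  finally have "real (card (busy_times j)) * threshold V j * real (min_dur j)
      \<le> 2 * B * demand (class_items j) * real (min_dur j)" by (simp add: algebra_simps)
  then show ?thesis using min_dur_pos[of j] q by (simp add: field_simps)
qed

text \<open>The ratio of two lengths in class \<open>j\<close> is bounded in two ways: the sharp bound
  \<open>M * (1 + 2 * \<eta> j)\<close> is needed for the closed bins, whose coefficient in front of the optimum must
  be exact, while the cruder \<open>B\<close> suffices for the bins in use.\<close>

lemma combined_cost_le:
  fixes \<eta> :: "nat \<Rightarrow> real"
  assumes L: "1/2 \<le> L" "(\<Sum>i\<in>{1..<last_class}. eps V i) \<le> L"
    and M: "1 \<le> M" and B: "0 \<le> B" and E: "0 \<le> E"
    and \<eta>: "\<And>j. j \<in> {1..last_class} \<Longrightarrow> 0 \<le> \<eta> j \<and> \<eta> j \<le> E"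
    and dur_M: "\<And>j. j \<in> {1..last_class} \<Longrightarrow> real (max_dur j) \<le> M * (1 + 2 * \<eta> j) * real (min_dur j)"
    and dur_B: "\<And>j. j \<in> {1..last_class} \<Longrightarrow> real (max_dur j) \<le> B * real (min_dur j)"
  shows "real (cost Is schedule) \<le> real T * (16 * sqrt (V * L) + 1)
    + (M * (P * real (opt_cost Is)) + 4 * M * E * demand {..<n})
    + real k * (4 * real T * sqrt (V * L) + 4 * B * sqrt (L / V) * demand {..<n})"
proof -
  let ?J = last_class
  have J: "1 \<le> ?J" using cls_le_last[OF Is_nonempty] by auto
  have disj: "i \<noteq> j \<Longrightarrow> handled i \<inter> handled j = {}" for i j by (auto simp: handled_def)
  have disj': "i \<noteq> j \<Longrightarrow> class_items i \<inter> class_items j = {}" for i j by (auto simp: class_items_def)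
  have thr: "(\<Sum>j=1..?J. threshold V j) \<le> 4 * sqrt (V * L)"
    by (rule sum_threshold_le[OF V L J])
  have sum_dem: "(\<Sum>j=1..?J. demand (class_items j)) \<le> demand {..<n}"
    using handled_subset(2) disj' by (rule sum_demand_disjoint)
  have dem0: "0 \<le> demand (class_items j)" for j using demand_nonneg handled_subset(2) .
  have split: "real (cost Is schedule) \<le> real (card (busy schedule (handled 0)))
      + (\<Sum>j=1..?J. real (card (busy schedule (handled j))))"
  proof -
    have "busy schedule {..<n} \<subseteq> busy schedule (handled 0) \<union> (\<Union>j\<in>{1..?J}. busy schedule (handled j))"
    proof
      fix z assume "z \<in> busy schedule {..<n}"
      then obtain i t where i: "i < n" "act i t" "z = (schedule i, t)" by (auto simp: busy_def)
      then have "z \<in> busy schedule (handled (handler V Is l i))" by (auto simp: busy_def handled_def)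
      then show "z \<in> busy schedule (handled 0) \<union> (\<Union>j\<in>{1..?J}. busy schedule (handled j))"
        using handler_range[OF i(1)] by (cases "handler V Is l i = 0") auto
    qed
    then have "card (busy schedule {..<n})
        \<le> card (busy schedule (handled 0) \<union> (\<Union>j\<in>{1..?J}. busy schedule (handled j)))"
      using finite_busy[OF handled_subset(1)] by (intro card_mono) auto
    also have "\<dots> \<le> card (busy schedule (handled 0)) + (\<Sum>j=1..?J. card (busy schedule (handled j)))"
      by (rule order_trans[OF card_Un_le add_left_mono[OF card_UN_le]]) simp
    finally show ?thesis unfolding cost_eq_card_busy by (simp flip: of_nat_sum of_nat_add)
  qed
  have ff: "real (card (busy schedule (handled 0))) \<le> real T * (16 * sqrt (V * L) + 1)"
    by (rule order_trans[OF first_fit_cost mult_left_mono]) (use thr in auto)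
  have closed_dem: "real (min_dur j) * real (nclosed j) \<le> 2 * demand (class_items j)" if "1 \<le> j" for j
  proof -
    have "real (min_dur j) * real (nclosed j) \<le> real (min_dur j) * (2 * sum_list (sizes_before (handled j) n))"
      using C sizes_before_in[OF handled_subset(1), of _ j n]
      by (intro mult_left_mono sum_class_closed_le_twice_sum) (auto simp: less_imp_le)
    also have "\<dots> = 2 * (real (min_dur j) * sum_list (sizes_before (handled j) n))" by simp
    also have "\<dots> \<le> 2 * demand (handled j)"
      using handled_subset(1) handled_class[OF that] dur_bounds
      by (intro mult_left_mono mult_sum_sizes_le_demand) auto
    also have "\<dots> \<le> 2 * demand (class_items j)"
      using demand_mono[OF handled_class[OF that] handled_subset(2)] by simp
    finally show ?thesis .
  qed
  have main: "(\<Sum>j=1..?J. real (max_dur j) * real (nclosed j))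
      \<le> M * (P * real (opt_cost Is)) + 4 * M * E * demand {..<n}"
  proof -
    have "(\<Sum>j=1..?J. real (max_dur j) * real (nclosed j))
        \<le> (\<Sum>j=1..?J. M * (real (min_dur j) * real (nclosed j)) + 4 * M * E * demand (class_items j))"
    proof (intro sum_mono)
      fix j assume j: "j \<in> {1..?J}"
      let ?x = "real (min_dur j) * real (nclosed j)"
      have "real (max_dur j) * real (nclosed j) \<le> M * (1 + 2 * \<eta> j) * real (min_dur j) * real (nclosed j)"
        by (rule mult_right_mono[OF dur_M[OF j] of_nat_0_le_iff])
      \<comment> \<open>Only the slack \<open>2 * M * \<eta> j\<close> is charged to the demand; the
        first summand keeps the coefficient \<open>M\<close> and is compared with the optimum after
        summation over all classes.\<close>
      also have "\<dots> = M * ?x + (2 * M * \<eta> j) * ?x" by (simp add: algebra_simps)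
      also have "\<dots> \<le> M * ?x + (2 * M * E) * (2 * demand (class_items j))"
      proof (rule add_left_mono[OF mult_mono])
        show "2 * M * \<eta> j \<le> 2 * M * E" using \<eta>[OF j] M by (intro mult_left_mono) auto
        show "?x \<le> 2 * demand (class_items j)" using closed_dem j by simp
        show "0 \<le> 2 * M * E" using M E by simp
        show "0 \<le> ?x" by (rule mult_nonneg_nonneg[OF of_nat_0_le_iff of_nat_0_le_iff])
      qed
      finally show "real (max_dur j) * real (nclosed j) \<le> M * ?x + 4 * M * E * demand (class_items j)"
        by simp
    qed
    also have "\<dots> = M * real (\<Sum>j=1..?J. min_dur j * nclosed j)
        + 4 * M * E * (\<Sum>j=1..?J. demand (class_items j))"
      by (simp only: sum.distrib sum_distrib_left of_nat_sum of_nat_mult)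
    also have "\<dots> \<le> M * (P * real (opt_cost Is)) + 4 * M * E * demand {..<n}"
    proof (intro add_mono mult_left_mono sum_dem)
      \<comment> \<open>\<open>closed_le_opt\<close> wants a lower bound on durations for every
        index, including \<open>handled 0\<close>, which is not part of a length class. The value 0
        makes that demand trivial, and the sum starts at 1.\<close>
      let ?a = "\<lambda>j. if j = 0 then 0 else min_dur j"
      have "real (\<Sum>j=1..?J. min_dur j * nclosed j) = real (\<Sum>j=1..?J. ?a j * nclosed j)"
        by (intro arg_cong[of _ _ real] sum.cong) auto
      also have "\<dots> \<le> P * real (opt_cost Is)"
        using handled_subset(1) disj
      proof (rule closed_le_opt)
        fix j i assume "i \<in> handled j"
        then have "j = 0 \<or> i \<in> class_items j" using handled_class[of j] by (cases "j = 0") auto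
        then show "?a j \<le> dur i" using dur_bounds[of i j] by (cases "j = 0") auto
      qed
      finally show "real (\<Sum>j=1..?J. min_dur j * nclosed j) \<le> P * real (opt_cost Is)" .
    qed (use M E in auto)
    finally show ?thesis .
  qed
  have times: "(\<Sum>j=1..?J. real (card (busy_times j)))
      \<le> 4 * real T * sqrt (V * L) + 4 * B * sqrt (L / V) * demand {..<n}"
  proof -
    have "(\<Sum>j=1..?J. real (card (busy_times j)))
        \<le> (\<Sum>j=1..?J. real T * threshold V j + 4 * B * sqrt (L / V) * demand (class_items j))"
    proof (intro sum_mono)
      fix j assume j: "j \<in> {1..?J}"
      have nonneg: "0 \<le> 4 * B * sqrt (L / V) * demand (class_items j)"
        using B dem0 V L by (intro mult_nonneg_nonneg) auto
      show "real (card (busy_times j)) \<le> real T * threshold V j + 4 * B * sqrt (L / V) * demand (class_items j)"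
      \<comment> \<open>With threshold 1 the trivial bound \<open>T\<close> equals the first
        summand; with a smaller threshold the demand bound yields the second.\<close>
      proof (cases "threshold V j = 1")
        case True
        then show ?thesis using card_busy_times_le_T[of j] nonneg by simp
      next
        case False
        then have q: "threshold V j < 1" by (simp add: threshold_def min_def split: if_splits)
        have pos: "0 < threshold V j" using V j by (simp add: threshold_def)
        have "real (card (busy_times j)) \<le> 2 * B * demand (class_items j) * (1 / threshold V j)"
          using card_busy_times_le[OF _ dur_B[OF j] pos] j by simp
        also have "\<dots> \<le> 2 * B * demand (class_items j) * (2 * sqrt (L / V))"
          using inverse_threshold_le[OF V L j q] B dem0 by (intro mult_left_mono mult_nonneg_nonneg) auto
        also have "\<dots> \<le> real T * threshold V j + 4 * B * sqrt (L / V) * demand (class_items j)"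
          using threshold_nonneg[of j] by (simp add: algebra_simps)
        finally show ?thesis .
      qed
    qed
    also have "\<dots> = real T * (\<Sum>j=1..?J. threshold V j)
        + 4 * B * sqrt (L / V) * (\<Sum>j=1..?J. demand (class_items j))"
      by (simp only: sum.distrib sum_distrib_left)
    also have "\<dots> \<le> real T * (4 * sqrt (V * L)) + 4 * B * sqrt (L / V) * demand {..<n}"
      using thr sum_dem B V L by (intro add_mono mult_left_mono) auto
    finally show ?thesis by (simp add: algebra_simps)
  qed
  have "(\<Sum>j=1..?J. real (card (busy schedule (handled j))))
      \<le> (\<Sum>j=1..?J. real (max_dur j) * real (nclosed j) + real k * real (card (busy_times j)))"
    by (intro sum_mono nonclairvoyant_cost) simp
  also have "\<dots> = (\<Sum>j=1..?J. real (max_dur j) * real (nclosed j))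
      + real k * (\<Sum>j=1..?J. real (card (busy_times j)))"
    by (simp only: sum.distrib sum_distrib_left)
  also have "\<dots> \<le> (M * (P * real (opt_cost Is)) + 4 * M * E * demand {..<n})
      + real k * (4 * real T * sqrt (V * L) + 4 * B * sqrt (L / V) * demand {..<n})"
    using main times by (intro add_mono mult_left_mono) auto
  finally show ?thesis using split ff by linarith
qed

section \<open>Inserting the prediction errors\<close>

lemma dur_le_max_length: "i < n \<Longrightarrow> real (dur i) \<le> max_length Is"
  unfolding max_length_def len_eq_dur[symmetric] by (intro Max_ge) auto

text \<open>If \<open>1 + lam \<le> \<mu>\<close>, the largest given length is at most \<open>\<mu>\<^sup>2\<close>. Otherwise \<open>\<mu>\<close> itself is a good
  bound for the ratio of two lengths, and the factor \<open>1 + lam\<close> absorbs \<open>\<mu> * sqrt (ln (1 + lam))\<close>.\<close>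

lemma combined_cost_le_predictions:
  fixes \<delta> \<alpha> lam :: real
  defines "v \<equiv> avg_load T Is" and "\<mu> \<equiv> max_length Is"
  assumes k: "1 \<le> k" and nonneg: "0 \<le> \<delta>" "0 \<le> \<alpha>" "0 \<le> lam" and \<mu>: "2 \<le> \<mu>"
    and V_bounds: "v / (1 + \<delta>) \<le> V" "V \<le> v * (1 + \<delta>)"
    and l_bounds: "\<And>i. i < n \<Longrightarrow> len (Is ! i) / (1 + \<alpha>) \<le> l i \<and> l i \<le> len (Is ! i) * (1 + lam)"
  shows "real (cost Is schedule) \<le> (1 + \<alpha>) * (1 + lam) *
    (P * real (opt_cost Is) + real T * real k * (63 * sqrt ((1 + \<delta>) * v * ln \<mu>)))"
proof -
  define R where "R = (1 + \<alpha>) * (1 + lam)"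
  \<comment> \<open>Given lengths reach up to \<open>\<mu> * (1 + lam)\<close>, so this is the total
    width available to the classes before the last one.\<close>
  define L where "L = ln (\<mu> * (1 + lam))"
  define Z where "Z = sqrt ((1 + \<delta>) * v * ln \<mu>)"
  define Y where "Y = sqrt ((1 + \<delta>) * v * L)"
  define D where "D = demand {..<n}"
  have R_lam: "1 + lam \<le> R" using mult_right_mono[of 1 "1 + \<alpha>" "1 + lam"] nonneg by (simp add: R_def)
  then have R: "1 \<le> R" using nonneg by simp
  have v: "1 \<le> v" using avg_load_ge_1 by (simp add: v_def)
  have D: "0 \<le> D" "D \<le> real T * v"
    using demand_nonneg[OF order_refl] demand_le_avg_load by (auto simp: D_def v_def)
  have L_eq: "L = ln \<mu> + ln (1 + lam)" using \<mu> nonneg by (simp add: L_def ln_mult)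
  have "ln 2 \<le> ln \<mu>" using \<mu> by simp
  then have ln\<mu>: "1/2 \<le> ln \<mu>" using half_le_ln2 by linarith
  moreover have "0 \<le> ln (1 + lam)" using nonneg by simp
  ultimately have L: "1/2 \<le> L" by (simp add: L_eq)
  have given_le: "max 1 (l i) \<le> real (dur i) * (1 + lam)" if "i < n" for i
  proof -
    have "1 \<le> real (dur i)" using item(2)[OF that] by linarith
    then have "1 * 1 \<le> real (dur i) * (1 + lam)" using nonneg by (intro mult_mono) auto
    then show ?thesis
      using l_bounds[OF that] unfolding len_eq_dur[OF that] by (simp only: mult_1 max.bounded_iff)
  qed
  have sum_le: "(\<Sum>i\<in>{1..<last_class}. eps V i) \<le> L"
  proof -
    have "last_class \<in> cls ` {..<n}" unfolding last_class_def using Is_nonempty by (intro Max_in) auto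
    then obtain i where i: "i < n" "last_class = cls i" by auto
    have "exp (\<Sum>i\<in>{1..<last_class}. eps V i) \<le> max 1 (l i)"
      using length_class(2)[OF V] by (simp add: i(2) cls_def)
    also have "\<dots> \<le> real (dur i) * (1 + lam)" by (rule given_le[OF i(1)])
    also have "\<dots> \<le> \<mu> * (1 + lam)"
      using dur_le_max_length[OF i(1)] nonneg by (intro mult_right_mono) (auto simp: \<mu>_def)
    finally show ?thesis unfolding L_def using \<mu> nonneg by (subst ln_ge_iff) auto
  qed
  have eps01: "0 \<le> eps V j" "eps V j \<le> 1" for j using V by (auto simp: eps_def)
  \<comment> \<open>Each error enters once: \<open>1 + \<alpha>\<close> because the length of
    \<open>i\<close> may be understated, \<open>1 + lam\<close> because that of \<open>i'\<close>
    may be overstated.\<close>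
  have ratio: "real (dur i) \<le> R * exp (eps V j) * real (dur i')"
    if "i \<in> class_items j" "i' \<in> class_items j" for i i' j
  proof -
    have i: "i < n" "i' < n" "length_class V (l i) = j" "length_class V (l i') = j"
      using that by (auto simp: class_items_def cls_def)
    then have "1 \<le> j" using length_class(1)[OF V] by blast
    then have "{1..j} = insert j {1..<j}" by auto
    then have split: "(\<Sum>i\<in>{1..j}. eps V i) = (\<Sum>i\<in>{1..<j}. eps V i) + eps V j" by simp
    have "max 1 (l i) \<le> exp (\<Sum>i\<in>{1..j}. eps V i)"
      using length_class(3)[OF V, of "l i"] i(3) by simp
    also have "\<dots> = exp (eps V j) * exp (\<Sum>i\<in>{1..<j}. eps V i)"
      unfolding split exp_add by simp
    also have "\<dots> \<le> exp (eps V j) * max 1 (l i')"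
      using length_class(2)[OF V, of "l i'"] i(4) by (intro mult_left_mono) auto
    also have "\<dots> \<le> exp (eps V j) * (real (dur i') * (1 + lam))"
      using given_le[OF i(2)] by (intro mult_left_mono) auto
    finally have 1: "max 1 (l i) \<le> exp (eps V j) * (real (dur i') * (1 + lam))" .
    have "real (dur i) \<le> (1 + \<alpha>) * l i"
      using l_bounds[OF i(1)] len_eq_dur[OF i(1)] nonneg by (simp add: field_simps)
    also have "\<dots> \<le> (1 + \<alpha>) * max 1 (l i)" using nonneg by (intro mult_left_mono) auto
    also have "\<dots> \<le> (1 + \<alpha>) * (exp (eps V j) * (real (dur i') * (1 + lam)))"
      using 1 nonneg by (intro mult_left_mono) auto
    finally show ?thesis by (simp add: R_def mult_ac)
  qed
  have VL: "sqrt (V * L) \<le> Y"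
    unfolding Y_def using V_bounds(2) L by (intro real_sqrt_le_mono mult_right_mono) (auto simp: mult.commute)
  \<comment> \<open>An underestimated load costs at most \<open>v / V \<le> 1 + \<delta>\<close>,
    and \<open>D \<le> T * v\<close> turns \<open>sqrt (L / V)\<close> into the same error as
    \<open>sqrt (V * L)\<close>.\<close>
  have LV: "sqrt (L / V) * D \<le> real T * Y"
  proof -
    have "v * (v / V) \<le> v * (1 + \<delta>)"
      using V_bounds(1) V v nonneg by (intro mult_left_mono) (auto simp: field_simps)
    then have "v * (v / V) * L \<le> v * (1 + \<delta>) * L" using L by (intro mult_right_mono) auto
    then have "sqrt (L / V * v\<^sup>2) \<le> Y"
      unfolding Y_def by (intro real_sqrt_le_mono) (simp add: power2_eq_square mult_ac)
    then have "sqrt (L / V) * v \<le> Y" using v unfolding real_sqrt_mult real_sqrt_abs by simp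
    then have "real T * (sqrt (L / V) * v) \<le> real T * Y" by (intro mult_left_mono) auto
    moreover have "sqrt (L / V) * D \<le> sqrt (L / V) * (real T * v)"
      using D V L by (intro mult_left_mono) auto
    ultimately show ?thesis by (simp add: mult_ac)
  qed
  have Y: "1 \<le> 2 * Y"
  proof -
    have "1 * 1 * (1/2) \<le> (1 + \<delta>) * v * L" using nonneg v L by (intro mult_mono) auto
    then have "1/2 \<le> Y" unfolding Y_def by (intro real_le_rsqrt) (simp add: power2_eq_square)
    then show ?thesis by simp
  qed
  \<comment> \<open>The assumption on closed bins, taken for the empty sum.\<close>
  have P: "0 \<le> P * real (opt_cost Is)" using closed_le_opt[of "\<lambda>_. {}" "\<lambda>_. 0" 0] by simp
  define W where "W = real T * Y"
  have W: "0 \<le> W" using Y by (simp add: W_def)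
  have bound: "real (cost Is schedule) \<le> 18 * W + (M * (P * real (opt_cost Is)) + 4 * M * \<epsilon> * W)
      + real k * (4 * W + 4 * B * W)"
    if "1 \<le> M" "0 \<le> B" "0 \<le> \<epsilon>" "\<And>j. j \<in> {1..last_class} \<Longrightarrow> 0 \<le> \<eta> j \<and> \<eta> j \<le> \<epsilon> * sqrt (L / V)"
      "\<And>j. j \<in> {1..last_class} \<Longrightarrow> real (max_dur j) \<le> M * (1 + 2 * \<eta> j) * real (min_dur j)"
      "\<And>j. j \<in> {1..last_class} \<Longrightarrow> real (max_dur j) \<le> B * real (min_dur j)" for M B \<epsilon> \<eta>
  proof -
    have "0 \<le> \<epsilon> * sqrt (L / V)" using that(3) V L by simp
    note combined_cost_le[OF L sum_le that(1,2) this that(4-6)]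
    moreover have "real T * (16 * sqrt (V * L) + 1) \<le> 18 * W"
      using mult_left_mono[of "16 * sqrt (V * L) + 1" "18 * Y" "real T"] VL Y by (simp add: W_def mult_ac)
    moreover have "4 * M * (\<epsilon> * sqrt (L / V)) * D \<le> 4 * M * \<epsilon> * W"
      using mult_left_mono[OF LV, of "4 * M * \<epsilon>"] that(1,3) by (simp add: W_def mult_ac)
    moreover have "real k * (4 * real T * sqrt (V * L) + 4 * B * sqrt (L / V) * D)
        \<le> real k * (4 * W + 4 * B * W)"
    proof (intro mult_left_mono add_mono)
      show "4 * real T * sqrt (V * L) \<le> 4 * W"
        using mult_left_mono[OF VL, of "4 * real T"] by (simp add: W_def mult_ac)
      show "4 * B * sqrt (L / V) * D \<le> 4 * B * W"
        using mult_left_mono[OF LV, of "4 * B"] that(2) by (simp add: W_def mult_ac)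
    qed simp
    ultimately show ?thesis unfolding D_def by linarith
  qed
  have sqrt2: "sqrt 2 \<le> 3/2" by (intro real_le_lsqrt) (auto simp: power2_eq_square)
  have Z0: "0 \<le> Z" unfolding Z_def using nonneg v ln\<mu> by simp
  \<comment> \<open>The witness is \<open>R * W\<close> or \<open>\<mu> * W\<close>. The constant 42
    is 18 + 8 + 4 + 12 from the first case and also covers the second; 3/2 bounds the
    \<open>sqrt 2\<close> that arises from doubling the logarithm. Together they give 63.\<close>
  have "\<exists>x. real (cost Is schedule) \<le> R * (P * real (opt_cost Is)) + real k * (42 * x) \<and> x \<le> R * (3/2) * (real T * Z)"
  proof (cases "1 + lam \<le> \<mu>")
    case True
    have "real (cost Is schedule) \<le> 18 * W + (R * (P * real (opt_cost Is)) + 4 * R * 2 * W)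
        + real k * (4 * W + 4 * (3 * R) * W)"
    proof (rule bound[of R "3 * R" 2 "eps V"])
      fix j assume j: "j \<in> {1..last_class}"
      show "0 \<le> eps V j \<and> eps V j \<le> 2 * sqrt (L / V)"
        using eps01 eps_le[OF V L sum_le j] by simp
      have exp: "exp (eps V j) \<le> 1 + 2 * eps V j" using exp_le_affine eps01 by simp
      show "real (max_dur j) \<le> R * (1 + 2 * eps V j) * real (min_dur j)"
      proof (rule max_dur_le)
        show "1 \<le> R * (1 + 2 * eps V j)" using mult_mono[of 1 R 1 "1 + 2 * eps V j"] R eps01[of j] by simp
        fix i i' assume "i \<in> class_items j" "i' \<in> class_items j"
        then have "real (dur i) \<le> R * exp (eps V j) * real (dur i')" by (rule ratio)
        also have "\<dots> \<le> R * (1 + 2 * eps V j) * real (dur i')"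
          using exp R by (intro mult_right_mono mult_left_mono) auto
        finally show "real (dur i) \<le> R * (1 + 2 * eps V j) * real (dur i')" .
      qed
      also have "\<dots> \<le> R * 3 * real (min_dur j)"
        using eps01[of j] R by (intro mult_right_mono mult_left_mono) auto
      finally show "real (max_dur j) \<le> 3 * R * real (min_dur j)" by (simp add: mult_ac)
    qed (use R in auto)
    moreover have "18 * W + 4 * R * 2 * W + real k * (4 * W + 4 * (3 * R) * W) \<le> real k * (42 * (R * W))"
    proof -
      have "W \<le> R * W" using mult_right_mono[OF R W] by simp
      then have "18 * W + 4 * R * 2 * W \<le> 26 * (R * W)" "4 * W + 4 * (3 * R) * W \<le> 16 * (R * W)"
        by auto
      moreover have "26 * (R * W) \<le> real k * (26 * (R * W))"
        using mult_right_mono[of 1 "real k" "26 * (R * W)"] k R W by simp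
      moreover have "real k * (4 * W + 4 * (3 * R) * W) \<le> real k * (16 * (R * W))"
        using calculation(2) by (intro mult_left_mono) auto
      ultimately show ?thesis by (simp add: algebra_simps)
    qed
    moreover have "R * W \<le> R * (3/2) * (real T * Z)"
    proof -
      have "ln (1 + lam) \<le> ln \<mu>" using True nonneg by simp
      then have "Y \<le> sqrt (2 * ((1 + \<delta>) * v * ln \<mu>))"
        unfolding Y_def L_eq using nonneg v
        by (intro real_sqrt_le_mono) (simp add: mult_left_mono mult.left_commute[of 2])
      also have "\<dots> \<le> 3/2 * Z" unfolding Z_def real_sqrt_mult[of 2]
        using sqrt2 Z0 by (intro mult_right_mono) (auto simp: Z_def)
      finally have "R * (real T * Y) \<le> R * (real T * (3/2 * Z))"
        using R by (intro mult_left_mono) auto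
      then show ?thesis by (simp add: W_def mult_ac)
    qed
    ultimately show ?thesis by (intro exI[of _ "R * W"]) simp
  next
    case False
    have "real (cost Is schedule) \<le> 18 * W + (\<mu> * (P * real (opt_cost Is)) + 4 * \<mu> * 0 * W)
        + real k * (4 * W + 4 * \<mu> * W)"
    \<comment> \<open>Durations lie between 1 and \<open>\<mu>\<close>, so the ratio
      \<open>\<mu>\<close> holds without slack, and \<open>\<mu> < 1 + lam \<le> R\<close> keeps the
      coefficient of the optimum within \<open>R\<close>.\<close>
    proof (rule bound[of \<mu> \<mu> 0 "\<lambda>_. 0"])
      fix j
      show "real (max_dur j) \<le> \<mu> * real (min_dur j)"
      proof (rule max_dur_le)
        fix i i' assume "i \<in> class_items j" "i' \<in> class_items j"
        then have i: "i < n" "i' < n" by (auto simp: class_items_def)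
        have "real (dur i) \<le> \<mu> * 1" using dur_le_max_length[OF i(1)] by (simp add: \<mu>_def)
        also have "\<dots> \<le> \<mu> * real (dur i')" using item(2)[OF i(2)] \<mu> by (intro mult_left_mono) auto
        finally show "real (dur i) \<le> \<mu> * real (dur i')" .
      qed (use \<mu> in simp)
      then show "real (max_dur j) \<le> \<mu> * (1 + 2 * 0) * real (min_dur j)" by simp
    qed (use \<mu> in auto)
    moreover have "\<mu> * (P * real (opt_cost Is)) \<le> R * (P * real (opt_cost Is))"
      using False R_lam P by (intro mult_right_mono) auto
    moreover have "18 * W + real k * (4 * W + 4 * \<mu> * W) \<le> real k * (42 * (\<mu> * W))"
    proof -
      have "W \<le> \<mu> * W" using mult_right_mono[OF _ W, of 1 \<mu>] \<mu> by simp
      moreover have "0 \<le> \<mu> * W" using \<mu> W by simp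
      ultimately have "18 * W \<le> 34 * (\<mu> * W)" "4 * W + 4 * \<mu> * W \<le> 8 * (\<mu> * W)"
        by (simp_all add: mult.commute[of W])
      moreover have "34 * (\<mu> * W) \<le> real k * (34 * (\<mu> * W))"
        using mult_right_mono[of 1 "real k" "34 * (\<mu> * W)"] k \<mu> W by simp
      moreover have "real k * (4 * W + 4 * \<mu> * W) \<le> real k * (8 * (\<mu> * W))"
        using calculation(2) by (intro mult_left_mono) auto
      ultimately show ?thesis by (simp add: algebra_simps)
    qed
    moreover have "\<mu> * W \<le> R * (3/2) * (real T * Z)"
    proof -
      have "ln \<mu> \<le> ln (1 + lam)" using False \<mu> by simp
      then have "Y \<le> sqrt (2 * ((1 + \<delta>) * v) * ln (1 + lam))"
        unfolding Y_def L_eq using nonneg v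
        by (intro real_sqrt_le_mono) (simp add: mult_left_mono mult.assoc mult.left_commute[of 2])
      then have "Y \<le> sqrt 2 * sqrt ((1 + \<delta>) * v) * sqrt (ln (1 + lam))" by (simp only: real_sqrt_mult)
      then have "\<mu> * Y \<le> \<mu> * (sqrt 2 * sqrt ((1 + \<delta>) * v) * sqrt (ln (1 + lam)))"
        using \<mu> by (intro mult_left_mono) auto
      also have "\<dots> = sqrt 2 * sqrt ((1 + \<delta>) * v) * (\<mu> * sqrt (ln (1 + lam)))" by (simp add: mult_ac)
      also have "\<dots> \<le> sqrt 2 * sqrt ((1 + \<delta>) * v) * ((1 + lam) * sqrt (ln \<mu>))"
        using mult_sqrt_ln_le[OF \<mu>, of "1 + lam"] False nonneg v by (intro mult_left_mono) auto
      also have "\<dots> = sqrt 2 * ((1 + lam) * Z)" by (simp add: Z_def real_sqrt_mult mult_ac)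
      also have "\<dots> \<le> 3/2 * (R * Z)"
        using sqrt2 R_lam Z0 nonneg by (intro mult_mono) auto
      finally have "real T * (\<mu> * Y) \<le> real T * (3/2 * (R * Z))" by (intro mult_left_mono) auto
      then show ?thesis by (simp add: W_def mult_ac)
    qed
    ultimately show ?thesis by (intro exI[of _ "\<mu> * W"]) simp
  qed
  then obtain x where x: "real (cost Is schedule) \<le> R * (P * real (opt_cost Is)) + real k * (42 * x)"
    "x \<le> R * (3/2) * (real T * Z)" by blast
  have "real k * (42 * x) \<le> real k * (42 * (R * (3/2) * (real T * Z)))"
    using x(2) by (intro mult_left_mono) auto
  also have "\<dots> = R * (real T * real k * (63 * Z))" by simp
  finally show ?thesis
    using x(1) unfolding R_def[symmetric] Z_def[symmetric] distrib_left[of R] by linarith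
qed

end

end

text \<open>The non-clairvoyant algorithm only tests bins for equality, so pairing each bin with the
  constant class 0 changes no placement.\<close>

lemma combined_next_fit:
  "combined next_fit V Is l = combined (class_fit (\<lambda>_. 0)) V Is l"
proof -
  have "nonclairvoyant next_fit H I = nonclairvoyant (class_fit (\<lambda>_. 0)) H I" for H I
    by (simp add: nonclairvoyant_def class_fit_def)
  then have "placements next_fit V Is l i = placements (class_fit (\<lambda>_. 0)) V Is l i" for i
    by (induction i) (simp_all add: Let_def)
  then show ?thesis by (intro ext) (simp add: combined_def)
qed

lemma next_fit_bound:
  assumes "packing_instance T Is \<and> 2 \<le> max_length Is \<and>
            1 \<le> g \<and> (\<forall>I\<in>set Is. width I = 1 / real g) \<and>
            0 \<le> \<delta> \<and> 0 \<le> \<alpha> \<and> 0 \<le> lam \<and>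
            V \<in> {avg_load T Is / (1 + \<delta>) .. avg_load T Is * (1 + \<delta>)} \<and>
            (\<forall>i<length Is. l i \<in> {len (Is ! i) / (1 + \<alpha>) .. len (Is ! i) * (1 + lam)})"
  shows "real (cost Is (combined next_fit V Is l)) \<le> (1 + \<alpha>) * (1 + lam) *
    (real (opt_cost Is) + real T * (63 * sqrt ((1 + \<delta>) * avg_load T Is * ln (max_length Is))))"
proof -
  interpret packing T Is using assms by unfold_locales simp
  have "0 < avg_load T Is / (1 + \<delta>)" using avg_load_ge_1 assms by (intro divide_pos_pos) auto
  then have V: "0 < V" using assms by auto
  have "real (cost Is (combined (class_fit (\<lambda>_. 0)) V Is l)) \<le> (1 + \<alpha>) * (1 + lam) *
    (1 * real (opt_cost Is) + real T * real 1 * (63 * sqrt ((1 + \<delta>) * avg_load T Is * ln (max_length Is))))"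
    by (rule combined_cost_le_predictions[OF refl _ _ _ V next_fit_closed_le_opt])
      (use assms in auto)
  then show ?thesis by (simp add: combined_next_fit)
qed

lemma harmonic_bound:
  assumes "packing_instance T Is \<and> 2 \<le> max_length Is \<and>
            1 \<le> k \<and>
            0 \<le> \<delta> \<and> 0 \<le> \<alpha> \<and> 0 \<le> lam \<and>
            V \<in> {avg_load T Is / (1 + \<delta>) .. avg_load T Is * (1 + \<delta>)} \<and>
            (\<forall>i<length Is. l i \<in> {len (Is ! i) / (1 + \<alpha>) .. len (Is ! i) * (1 + lam)})"
  shows "real (cost Is (combined (harmonic k) V Is l)) \<le> (1 + \<alpha>) * (1 + lam) *
    (asymptotic_ratio (harmonic k) * real (opt_cost Is)
     + real T * real k * (63 * sqrt ((1 + \<delta>) * avg_load T Is * ln (max_length Is))))"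
proof -
  interpret packing T Is using assms by unfold_locales simp
  have "0 < avg_load T Is / (1 + \<delta>)" using avg_load_ge_1 assms by (intro divide_pos_pos) auto
  then have V: "0 < V" using assms by auto
  show ?thesis
    by (rule combined_cost_le_predictions[OF harmonic_eq_class_fit _ _ harmonic_class_in V harmonic_closed_le_opt])
      (use assms in auto)
qed

theorem theorem4p10:
  shows "(\<exists>C>0. \<forall>(T::nat) (Is::interval list) (g::nat) (V::real) (l::nat \<Rightarrow> real)
              (\<delta>::real) (\<alpha>::real) (lam::real).
            packing_instance T Is \<and> 2 \<le> max_length Is \<and>
            1 \<le> g \<and> (\<forall>I\<in>set Is. width I = 1 / real g) \<and>
            0 \<le> \<delta> \<and> 0 \<le> \<alpha> \<and> 0 \<le> lam \<and>
            V \<in> {avg_load T Is / (1 + \<delta>) .. avg_load T Is * (1 + \<delta>)} \<and>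
            (\<forall>i<length Is. l i \<in> {len (Is ! i) / (1 + \<alpha>) .. len (Is ! i) * (1 + lam)})
            \<longrightarrow> real (cost Is (combined next_fit V Is l))
                \<le> (1 + \<alpha>) * (1 + lam) *
                   (real (opt_cost Is)
                    + real T * (C * sqrt ((1 + \<delta>) * avg_load T Is * ln (max_length Is)))))
       \<and>
         (\<exists>C>0. \<forall>(T::nat) (Is::interval list) (k::nat) (V::real) (l::nat \<Rightarrow> real)
              (\<delta>::real) (\<alpha>::real) (lam::real).
            packing_instance T Is \<and> 2 \<le> max_length Is \<and>
            1 \<le> k \<and>
            0 \<le> \<delta> \<and> 0 \<le> \<alpha> \<and> 0 \<le> lam \<and>
            V \<in> {avg_load T Is / (1 + \<delta>) .. avg_load T Is * (1 + \<delta>)} \<and>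
            (\<forall>i<length Is. l i \<in> {len (Is ! i) / (1 + \<alpha>) .. len (Is ! i) * (1 + lam)})
            \<longrightarrow> real (cost Is (combined (harmonic k) V Is l))
                \<le> (1 + \<alpha>) * (1 + lam) *
                   (asymptotic_ratio (harmonic k) * real (opt_cost Is)
                    + real T * real k * (C * sqrt ((1 + \<delta>) * avg_load T Is * ln (max_length Is)))))"
proof (intro conjI exI[of _ 63] allI impI)
  show "0 < (63::real)" "0 < (63::real)" by simp_all
qed (rule next_fit_bound harmonic_bound; assumption)+

end
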